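(* Let $q\in\mathbb{C}$ be nonzero and not a root of unity, let $\widetilde{\mathcal L}=\widetilde{\mathfrak{sl}_2(\mathbb{C}_q)}$, and let $\mathcal V=\widetilde{\mathcal L}\otimes\widetilde{\mathcal L}$, regarded as an $\widetilde{\mathcal L}$-module under the diagonal adjoint action. Then $\operatorname{Der}(\widetilde{\mathcal L},\mathcal V)=\operatorname{Inn}(\widetilde{\mathcal L},\mathcal V)$; equivalently, $H^1(\widetilde{\mathcal L},\mathcal V)=0$.
   Context: All vector spaces and tensor products are over $\mathbb{C}$. **The Lie algebra.** Let $\mathbb{C}_q$ be the associative $\mathbb{C}$-algebra with generators $x^{\pm1},y^{\pm1}$ and relations $xx^{-1}=x^{-1}x=1$, $yy^{-1}=y^{-1}y=1$, $yx=qxy$ (it has basis $x^{m_1}y^{m_2}$, $(m_1,m_2)\in\mathbb{Z}^2$). Let $E_{ij}$ ($i,j\in\{1,2\}$) be the $2\times2$ matrix units. Let $\mathcal L=\mathfrak{sl}_2(\mathbb{C}_q)$ be the Lie algebra, under the commutator bracket of $M_2(\mathbb{C}_q)$, with basis $e_{\mathbf m}=E_{12}x^{m_1}y^{m_2}$, $f_{\mathbf m}=E_{21}x^{m_1}y^{m_2}$ for $\mathbf m=(m_1,m_2)\in\mathbb{Z}^2$, $d=E_{11}-E_{22}$, and $g_{\mathbf k}=E_{11}x^{k_1}y^{k_2}$, $h_{\mathbf k}=E_{22}x^{k_1}y^{k_2}$ for $\mathbf k=(k_1,k_2)\in\mathbb{Z}^2\setminus\{(0,0)\}$. It is $\mathbb{Z}^2$-graded,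 with $e_{\mathbf m},f_{\mathbf m},g_{\mathbf m},h_{\mathbf m}$ of degree $\mathbf m$ and $d$ of degree $(0,0)$. Then $\widetilde{\mathcal L}=\mathcal L\oplus\mathbb{C}d_1\oplus\mathbb{C}d_2$, where $[d_i,z]=m_iz$ for $z\in\mathcal L$ homogeneous of degree $(m_1,m_2)$, $i=1,2$, and $[d_1,d_2]=0$. **Derivations.** The diagonal adjoint action is $x\cdot(a\otimes b)=[x,a]\otimes b+a\otimes[x,b]$. $\operatorname{Der}(\widetilde{\mathcal L},\mathcal V)$ is the set of linear maps $D:\widetilde{\mathcal L}\to\mathcal V$ with $D([x,y])=x\cdot D(y)-y\cdot D(x)$ for all $x,y\in\widetilde{\mathcal L}$. $\operatorname{Inn}(\widetilde{\mathcal L},\mathcal V)$ is the set of maps $v_{\rm inn}:x\mapsto x\cdot v$, $v\in\mathcal V$. $H^1(\widetilde{\mathcal L},\mathcal V)\cong\operatorname{Der}(\widetilde{\mathcal L},\mathcal V)/\operatorname{Inn}(\widetilde{\mathcal L},\mathcal V)$ is the first cohomology group. *)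

theory Defs
  imports
    "HOL-Analysis.Cartesian_Space"
    "HOL-Library.Poly_Mapping"
    "HOL-Library.Product_Plus"
begin

section \<open>Complex vector spaces\<close>

class complex_vector = ab_group_add +
  fixes scaleC :: "complex \<Rightarrow> 'a \<Rightarrow> 'a" (infixr \<open>*\<^sub>C\<close> 75)
  assumes scaleC_add_right: "a *\<^sub>C (x + y) = a *\<^sub>C x + a *\<^sub>C y"
    and scaleC_add_left: "(a + b) *\<^sub>C x = a *\<^sub>C x + b *\<^sub>C x"
    and scaleC_scaleC: "a *\<^sub>C (b *\<^sub>C x) = (a * b) *\<^sub>C x"
    and scaleC_one: "1 *\<^sub>C x = x"

global_interpretation cvec: vector_space "scaleC :: complex \<Rightarrow> 'a \<Rightarrow> 'a::complex_vector"
  by standard (simp_all add: scaleC_add_right scaleC_add_left scaleC_scaleC scaleC_one)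

abbreviation clinear :: "('a::complex_vector \<Rightarrow> 'b::complex_vector) \<Rightarrow> bool" where
  "clinear \<equiv> Vector_Spaces.linear scaleC scaleC"

definition cbilinear ::
  "('a::complex_vector \<Rightarrow> 'b::complex_vector \<Rightarrow> 'c::complex_vector) \<Rightarrow> bool" where
  "cbilinear f \<longleftrightarrow> (\<forall>x. clinear (f x)) \<and> (\<forall>y. clinear (\<lambda>x. f x y))"

lemma clinearI:
  assumes "\<And>x y. f (x + y) = f x + f y" "\<And>c x. f (c *\<^sub>C x) = c *\<^sub>C f x"
  shows "clinear f"
  unfolding Vector_Spaces.linear_iff
  by (intro conjI allI assms cvec.vector_space_axioms)

lemma clinear_add: "clinear f \<Longrightarrow> f (x + y) = f x + f y"
  and clinear_scaleC: "clinear f \<Longrightarrow> f (c *\<^sub>C x) = c *\<^sub>C f x"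
  unfolding Vector_Spaces.linear_iff by blast+

lemma cbilinear_add_left: "cbilinear f \<Longrightarrow> f (x + x') y = f x y + f x' y"
  and cbilinear_add_right: "cbilinear f \<Longrightarrow> f x (y + y') = f x y + f x y'"
  and cbilinear_scaleC_left: "cbilinear f \<Longrightarrow> f (c *\<^sub>C x) y = c *\<^sub>C f x y"
  and cbilinear_scaleC_right: "cbilinear f \<Longrightarrow> f x (c *\<^sub>C y) = c *\<^sub>C f x y"
  unfolding cbilinear_def Vector_Spaces.linear_iff by blast+

lemmas cbilinear_simps =
  cbilinear_add_left cbilinear_add_right cbilinear_scaleC_left cbilinear_scaleC_right

lemma cbilinearI:
  assumes "\<And>x x' y. f (x + x') y = f x y + f x' y" "\<And>x y y'. f x (y + y') = f x y + f x y'"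
    and "\<And>c x y. f (c *\<^sub>C x) y = c *\<^sub>C f x y" "\<And>c x y. f x (c *\<^sub>C y) = c *\<^sub>C f x y"
  shows "cbilinear f"
  unfolding cbilinear_def by (intro conjI allI clinearI assms)

lemma clinear_diff: "clinear f \<Longrightarrow> f (x - y) = f x - f y"
  by (metis add_diff_cancel_right' clinear_add diff_add_cancel)

lemma clinear_zero: "clinear f \<Longrightarrow> f 0 = 0"
  by (metis clinear_diff diff_self)

instantiation complex :: complex_vector
begin
definition "c *\<^sub>C (z::complex) = c * z"
instance by standard (simp_all add: scaleC_complex_def algebra_simps)
end

instantiation prod :: (complex_vector, complex_vector) complex_vector
begin
definition "c *\<^sub>C (p :: 'a \<times> 'b) = (c *\<^sub>C fst p, c *\<^sub>C snd p)"
instance by standard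
  (simp_all add: scaleC_prod_def prod_eq_iff scaleC_add_right scaleC_add_left scaleC_scaleC scaleC_one)
end

instantiation vec :: (complex_vector, finite) complex_vector
begin
definition "c *\<^sub>C (v :: 'a ^ 'b) = (\<chi> i. c *\<^sub>C (v $ i))"
instance by standard
  (simp_all add: scaleC_vec_def vec_eq_iff scaleC_add_right scaleC_add_left scaleC_scaleC scaleC_one)
end

instantiation poly_mapping :: (type, complex_vector) complex_vector
begin
definition "c *\<^sub>C (p :: 'a \<Rightarrow>\<^sub>0 'b) = Poly_Mapping.map (scaleC c) p"
lemma lookup_scaleC [simp]:
  "Poly_Mapping.lookup (c *\<^sub>C (p :: 'a \<Rightarrow>\<^sub>0 'b)) k = c *\<^sub>C Poly_Mapping.lookup p k"
  by (simp add: scaleC_poly_mapping_def Poly_Mapping.map.rep_eq when_def)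
instance
  by standard (auto intro!: poly_mapping_eqI simp: lookup_add scaleC_add_right scaleC_add_left
      scaleC_scaleC scaleC_one)
end

text \<open>The linear extension to \<open>'k \<Rightarrow>\<^sub>0 complex\<close>, the vector space with basis \<open>'k\<close>.\<close>

definition lin_ext :: "('k \<Rightarrow> 'b::complex_vector) \<Rightarrow> ('k \<Rightarrow>\<^sub>0 complex) \<Rightarrow> 'b" where
  "lin_ext F p = (\<Sum>k\<in>Poly_Mapping.keys p. Poly_Mapping.lookup p k *\<^sub>C F k)"

abbreviation basis_vec :: "'k \<Rightarrow> ('k \<Rightarrow>\<^sub>0 complex)" where
  "basis_vec k \<equiv> Poly_Mapping.single k 1"

lemma lin_ext_superset:
  assumes "finite S" "Poly_Mapping.keys p \<subseteq> S"
  shows "lin_ext F p = (\<Sum>k\<in>S. Poly_Mapping.lookup p k *\<^sub>C F k)"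
  unfolding lin_ext_def using assms
  by (intro sum.mono_neutral_left) (auto simp: in_keys_iff)

lemma clinear_lin_ext: "clinear (lin_ext F)"
proof (rule clinearI)
  fix p r :: "'a \<Rightarrow>\<^sub>0 complex"
  let ?S = "Poly_Mapping.keys p \<union> Poly_Mapping.keys r"
  have "Poly_Mapping.keys (p + r) \<subseteq> ?S" by (rule Poly_Mapping.keys_add)
  then show "lin_ext F (p + r) = lin_ext F p + lin_ext F r"
    by (simp add: lin_ext_superset[of ?S] lookup_add scaleC_add_left sum.distrib)
next
  fix c and p :: "'a \<Rightarrow>\<^sub>0 complex"
  have "Poly_Mapping.keys (c *\<^sub>C p) \<subseteq> Poly_Mapping.keys p"
    by (auto simp: in_keys_iff scaleC_complex_def)
  then show "lin_ext F (c *\<^sub>C p) = c *\<^sub>C lin_ext F p"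
    by (simp add: lin_ext_superset[of "Poly_Mapping.keys p"] cvec.scale_sum_right scaleC_complex_def)
qed

lemma lin_ext_basis_vec [simp]: "lin_ext F (basis_vec k) = F k"
  by (simp add: lin_ext_def scaleC_one)

lemma lin_ext_ident: "lin_ext basis_vec p = p"
proof (rule poly_mapping_eqI)
  fix k
  have "Poly_Mapping.lookup (lin_ext basis_vec p) k =
      (\<Sum>i\<in>Poly_Mapping.keys p. if i = k then Poly_Mapping.lookup p i else 0)"
    unfolding lin_ext_def lookup_sum
    by (rule sum.cong) (auto simp: lookup_single scaleC_complex_def)
  then show "Poly_Mapping.lookup (lin_ext basis_vec p) k = Poly_Mapping.lookup p k"
    by (simp add: in_keys_iff)
qed

section \<open>Tensor products\<close>

text \<open>The tensor product is the free vector space on \<open>'a \<times> 'b\<close> modulo the bilinearity relations.\<close>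

definition tensor_relators ::
  "(('a::complex_vector \<times> 'b::complex_vector) \<Rightarrow>\<^sub>0 complex) set" where
  "tensor_relators =
     {basis_vec (a + a', b) - basis_vec (a, b) - basis_vec (a', b) | a a' b. True} \<union>
     {basis_vec (a, b + b') - basis_vec (a, b) - basis_vec (a, b') | a b b'. True} \<union>
     {basis_vec (c *\<^sub>C a, b) - c *\<^sub>C basis_vec (a, b) | c a b. True} \<union>
     {basis_vec (a, c *\<^sub>C b) - c *\<^sub>C basis_vec (a, b) | c a b. True}"

definition tensor_rel ::
  "(('a::complex_vector \<times> 'b::complex_vector) \<Rightarrow>\<^sub>0 complex) \<Rightarrow> (('a \<times> 'b) \<Rightarrow>\<^sub>0 complex) \<Rightarrow> bool" where
  "tensor_rel u v \<longleftrightarrow> u - v \<in> cvec.span tensor_relators"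

lemma equivp_tensor_rel: "equivp tensor_rel"
proof (intro equivpI reflpI sympI transpI)
  show "tensor_rel u u" for u
    by (simp add: tensor_rel_def cvec.span_zero)
  show "tensor_rel v u" if "tensor_rel u v" for u v
    using that unfolding tensor_rel_def by (metis cvec.span_neg minus_diff_eq)
  show "tensor_rel u w" if "tensor_rel u v" "tensor_rel v w" for u v w
    using cvec.span_add[OF that[unfolded tensor_rel_def]] by (simp add: tensor_rel_def)
qed

quotient_type (overloaded) ('a, 'b) tensor =
  "('a::complex_vector \<times> 'b::complex_vector) \<Rightarrow>\<^sub>0 complex" / tensor_rel
  by (rule equivp_tensor_rel)

instantiation tensor :: (complex_vector, complex_vector) complex_vector
begin

lift_definition zero_tensor :: "('a, 'b) tensor" is 0 .

lift_definition plus_tensor :: "('a, 'b) tensor \<Rightarrow> ('a, 'b) tensor \<Rightarrow> ('a, 'b) tensor" is "(+)"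
  unfolding tensor_rel_def by (metis add_diff_add cvec.span_add)

lift_definition uminus_tensor :: "('a, 'b) tensor \<Rightarrow> ('a, 'b) tensor" is uminus
  unfolding tensor_rel_def by (metis cvec.span_neg minus_diff_minus)

lift_definition minus_tensor :: "('a, 'b) tensor \<Rightarrow> ('a, 'b) tensor \<Rightarrow> ('a, 'b) tensor" is "(-)"
  unfolding tensor_rel_def
proof -
  fix u v u' v' :: "('a \<times> 'b) \<Rightarrow>\<^sub>0 complex"
  assume "u - v \<in> cvec.span tensor_relators" "u' - v' \<in> cvec.span tensor_relators"
  then have "(u - v) - (u' - v') \<in> cvec.span tensor_relators" by (rule cvec.span_diff)
  then show "u - u' - (v - v') \<in> cvec.span tensor_relators" by (simp add: algebra_simps)
qed

lift_definition scaleC_tensor :: "complex \<Rightarrow> ('a, 'b) tensor \<Rightarrow> ('a, 'b) tensor" is "scaleC"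
  unfolding tensor_rel_def by (metis cvec.scale_right_diff_distrib cvec.span_scale)

instance
proof
  fix x y z :: "('a, 'b) tensor" and c d :: complex
  have refl: "tensor_rel u u" for u :: "('a \<times> 'b) \<Rightarrow>\<^sub>0 complex"
    by (simp add: tensor_rel_def cvec.span_zero)
  show "x + y + z = x + (y + z)" by transfer (simp add: add.assoc refl)
  show "x + y = y + x" by transfer (simp add: add.commute refl)
  show "0 + x = x" by transfer (simp add: refl)
  show "- x + x = 0" by transfer (simp add: refl)
  show "x - y = x + - y" by transfer (simp add: refl)
  show "c *\<^sub>C (x + y) = c *\<^sub>C x + c *\<^sub>C y" by transfer (simp add: scaleC_add_right refl)
  show "(c + d) *\<^sub>C x = c *\<^sub>C x + d *\<^sub>C x" by transfer (simp add: scaleC_add_left refl)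
  show "c *\<^sub>C (d *\<^sub>C x) = (c * d) *\<^sub>C x" by transfer (simp add: refl)
  show "1 *\<^sub>C x = x" by transfer (simp add: refl)
qed

end

lift_definition tensor_of :: "'a::complex_vector \<Rightarrow> 'b::complex_vector \<Rightarrow> ('a, 'b) tensor"
    (infixl \<open>\<otimes>\<^sub>t\<close> 76)
  is "\<lambda>a b. basis_vec (a, b)" .

lemma cbilinear_tensor_of: "cbilinear (\<otimes>\<^sub>t)"
proof (rule cbilinearI)
  fix a a' :: 'a and b b' :: 'b and c :: complex
  show "a \<otimes>\<^sub>t (b + b') = a \<otimes>\<^sub>t b + a \<otimes>\<^sub>t b'"
    by transfer (unfold tensor_rel_def tensor_relators_def diff_diff_eq[symmetric],
        rule cvec.span_base, blast)
  show "(a + a') \<otimes>\<^sub>t b = a \<otimes>\<^sub>t b + a' \<otimes>\<^sub>t b"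
    by transfer (unfold tensor_rel_def tensor_relators_def diff_diff_eq[symmetric],
        rule cvec.span_base, blast)
  show "a \<otimes>\<^sub>t (c *\<^sub>C b) = c *\<^sub>C (a \<otimes>\<^sub>t b)"
    by transfer (unfold tensor_rel_def tensor_relators_def, rule cvec.span_base, blast)
  show "(c *\<^sub>C a) \<otimes>\<^sub>t b = c *\<^sub>C (a \<otimes>\<^sub>t b)"
    by transfer (unfold tensor_rel_def tensor_relators_def, rule cvec.span_base, blast)
qed

text \<open>The linear map on the tensor product induced by a bilinear map \<open>f\<close>. The chosen representative
  \<open>rep_tensor t\<close> is immaterial only when \<open>f\<close> is bilinear.\<close>

definition tensor_lift ::
  "('a::complex_vector \<Rightarrow> 'b::complex_vector \<Rightarrow> 'c::complex_vector) \<Rightarrow> ('a, 'b) tensor \<Rightarrow> 'c" where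
  "tensor_lift f t = lin_ext (\<lambda>(a, b). f a b) (rep_tensor t)"

lemma tensor_lift_abs:
  assumes "cbilinear f"
  shows "tensor_lift f (abs_tensor u) = lin_ext (\<lambda>(a, b). f a b) u"
proof -
  let ?L = "lin_ext (\<lambda>(a, b). f a b)"
  have lin: "clinear ?L" by (rule clinear_lin_ext)
  have rel: "?L r = 0" if "r \<in> tensor_relators" for r
    using that unfolding tensor_relators_def
    by (auto simp: clinear_diff[OF lin] clinear_scaleC[OF lin] cbilinear_simps[OF assms])
  have "?L r = 0" if "r \<in> cvec.span tensor_relators" for r
    using that
  proof (induction rule: cvec.span_induct_alt)
    case base
    show ?case by (rule clinear_zero[OF lin])
  next
    case (step c x y)
    then show ?case by (simp add: clinear_add[OF lin] clinear_scaleC[OF lin] rel)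
  qed
  moreover have "rep_tensor (abs_tensor u) - u \<in> cvec.span tensor_relators"
    using rep_abs_rsp_left[OF Quotient3_tensor] equivp_reflp[OF equivp_tensor_rel]
    by (metis tensor_rel_def)
  ultimately have "?L (rep_tensor (abs_tensor u) - u) = 0" by blast
  then show ?thesis by (simp add: tensor_lift_def clinear_diff[OF lin])
qed

lemma tensor_lift_tensor_of:
  assumes "cbilinear f"
  shows "tensor_lift f (a \<otimes>\<^sub>t b) = f a b"
  by (simp add: tensor_of.abs_eq tensor_lift_abs[OF assms])

lemma clinear_tensor_lift:
  assumes "cbilinear f"
  shows "clinear (tensor_lift f)"
proof (rule clinearI)
  fix x y :: "('a, 'b) tensor" and c :: complex
  obtain u v where [simp]: "x = abs_tensor u" "y = abs_tensor v"
    by (metis Quotient3_abs_rep[OF Quotient3_tensor])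
  show "tensor_lift f (x + y) = tensor_lift f x + tensor_lift f y"
    by (simp add: plus_tensor.abs_eq tensor_lift_abs[OF assms] clinear_add[OF clinear_lin_ext])
  show "tensor_lift f (c *\<^sub>C x) = c *\<^sub>C tensor_lift f x"
    by (simp add: scaleC_tensor.abs_eq tensor_lift_abs[OF assms] clinear_scaleC[OF clinear_lin_ext])
qed

section \<open>The quantum torus and its matrices\<close>

text \<open>The underlying vector space does not depend on \<open>q\<close>: \<open>basis_vec (m1, m2)\<close> is the monomial
  \<open>x ^ m1 y ^ m2\<close>. The parameter \<open>q\<close> enters through the product
  \<open>(x ^ m1 y ^ m2) (x ^ n1 y ^ n2) = q ^ (m2 n1) x ^ (m1 + n1) y ^ (m2 + n2)\<close>;
  the product that \<open>Poly_Mapping\<close> provides on this type is not used.\<close>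

type_synonym qtorus = "(int \<times> int) \<Rightarrow>\<^sub>0 complex"

definition qmult :: "complex \<Rightarrow> qtorus \<Rightarrow> qtorus \<Rightarrow> qtorus" where
  "qmult q a b =
     lin_ext (\<lambda>m. lin_ext (\<lambda>n. (q powi (snd m * fst n)) *\<^sub>C basis_vec (m + n)) b) a"

lemma qmult_basis_vec:
  "qmult q (basis_vec m) (basis_vec n) = (q powi (snd m * fst n)) *\<^sub>C basis_vec (m + n)"
  by (simp add: qmult_def)

lemma qtorus_relation:
  "qmult q (basis_vec (0, 1)) (basis_vec (1, 0)) =
     q *\<^sub>C qmult q (basis_vec (1, 0)) (basis_vec (0, 1))"
  by (simp add: qmult_basis_vec scaleC_one)

lemma clinear_lin_ext_fun:
  assumes "\<And>k. clinear (F k)"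
  shows "clinear (\<lambda>b. lin_ext (\<lambda>k. F k b) a)"
  by (rule clinearI)
    (simp_all add: lin_ext_def clinear_add[OF assms] clinear_scaleC[OF assms] scaleC_add_right
      sum.distrib cvec.scale_sum_right mult.commute)

lemma cbilinear_qmult: "cbilinear (qmult q)"
  unfolding cbilinear_def qmult_def
  by (auto intro: clinear_lin_ext_fun clinear_lin_ext)

lemma cbilinear_eqI_basis:
  assumes "cbilinear f" "cbilinear g" "\<And>m n. f (basis_vec m) (basis_vec n) = g (basis_vec m) (basis_vec n)"
  shows "f a b = g a b"
proof -
  have *: "h p = h' p" if "clinear h" "clinear h'" "\<And>k. h (basis_vec k) = h' (basis_vec k)"
    for h h' :: "('k \<Rightarrow>\<^sub>0 complex) \<Rightarrow> 'z::complex_vector" and p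
  proof -
    have ext: "k p = lin_ext (\<lambda>i. k (basis_vec i)) p" if "clinear k" 
      for k :: "('k \<Rightarrow>\<^sub>0 complex) \<Rightarrow> 'z"
    proof -
      have "k (sum g S) = (\<Sum>i\<in>S. k (g i))" for g and S :: "'k set"
        by (induction S rule: infinite_finite_induct)
          (simp_all add: clinear_zero[OF \<open>clinear k\<close>] clinear_add[OF \<open>clinear k\<close>])
      then show ?thesis
        by (subst lin_ext_ident[of p, symmetric])
          (simp add: lin_ext_def clinear_scaleC[OF \<open>clinear k\<close>])
    qed
    show ?thesis unfolding ext[OF that(1)] ext[OF that(2)] using that(3) by simp
  qed
  have "f (basis_vec m) b = g (basis_vec m) b" for m
    by (rule *) (use assms in \<open>auto simp: cbilinear_def\<close>)
  then show ?thesis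
    using *[of "\<lambda>a. f a b" "\<lambda>a. g a b" a] assms by (auto simp: cbilinear_def)
qed

lemma qmult_coeff_zero_commute:
  "Poly_Mapping.lookup (qmult q a b) 0 = Poly_Mapping.lookup (qmult q b a) 0"
proof (rule cbilinear_eqI_basis[of "\<lambda>a b. Poly_Mapping.lookup (qmult q a b) 0"
      "\<lambda>a b. Poly_Mapping.lookup (qmult q b a) 0"])
  show "cbilinear (\<lambda>a b. Poly_Mapping.lookup (qmult q a b) 0)"
    "cbilinear (\<lambda>a b. Poly_Mapping.lookup (qmult q b a) 0)"
    by (auto intro!: cbilinearI simp: cbilinear_simps[OF cbilinear_qmult] lookup_add)
  fix m n :: "int \<times> int"
  show "Poly_Mapping.lookup (qmult q (basis_vec m) (basis_vec n)) 0 =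
      Poly_Mapping.lookup (qmult q (basis_vec n) (basis_vec m)) 0"
  proof (cases "m + n = 0")
    case True
    then have "n = - m" by (simp add: eq_neg_iff_add_eq_0 add.commute)
    then show ?thesis by (simp add: qmult_basis_vec mult.commute)
  next
    case False
    then show ?thesis by (simp add: qmult_basis_vec lookup_single_not_eq add.commute)
  qed
qed

type_synonym qmat = "qtorus ^ 2 ^ 2"

definition qmat_mult :: "complex \<Rightarrow> qmat \<Rightarrow> qmat \<Rightarrow> qmat" where
  "qmat_mult q A B = (\<chi> i j. \<Sum>k\<in>UNIV. qmult q (A $ i $ k) (B $ k $ j))"

definition qmat_bracket :: "complex \<Rightarrow> qmat \<Rightarrow> qmat \<Rightarrow> qmat" where
  "qmat_bracket q A B = qmat_mult q A B - qmat_mult q B A"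

definition mat_unit :: "2 \<Rightarrow> 2 \<Rightarrow> qtorus \<Rightarrow> qmat" where
  "mat_unit i j a = (\<chi> k l. if k = i \<and> l = j then a else 0)"

lemma cbilinear_qmat_mult: "cbilinear (qmat_mult q)"
  by (rule cbilinearI)
    (simp_all add: qmat_mult_def vec_eq_iff cbilinear_simps[OF cbilinear_qmult] scaleC_vec_def
      sum.distrib cvec.scale_sum_right)

lemma cbilinear_qmat_bracket: "cbilinear (qmat_bracket q)"
  by (rule cbilinearI)
    (simp_all add: qmat_bracket_def cbilinear_simps[OF cbilinear_qmat_mult]
      cvec.scale_right_diff_distrib)

section \<open>The Lie algebra \<open>sl\<^sub>2(\<complex>\<^sub>q)\<close>\<close>

definition e_mat :: "int \<times> int \<Rightarrow> qmat" where "e_mat m = mat_unit 1 2 (basis_vec m)"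
definition f_mat :: "int \<times> int \<Rightarrow> qmat" where "f_mat m = mat_unit 2 1 (basis_vec m)"
definition g_mat :: "int \<times> int \<Rightarrow> qmat" where "g_mat k = mat_unit 1 1 (basis_vec k)"
definition h_mat :: "int \<times> int \<Rightarrow> qmat" where "h_mat k = mat_unit 2 2 (basis_vec k)"
definition d_mat :: qmat where "d_mat = mat_unit 1 1 (basis_vec 0) - mat_unit 2 2 (basis_vec 0)"

definition sl2_basis :: "qmat set" where
  "sl2_basis = {e_mat m | m. True} \<union> {f_mat m | m. True} \<union> {d_mat} \<union>
     {g_mat k | k. k \<noteq> 0} \<union> {h_mat k | k. k \<noteq> 0}"

lemma clinear_mat_unit: "clinear (mat_unit i j)"
  by (rule clinearI) (auto simp: mat_unit_def vec_eq_iff scaleC_vec_def)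

text \<open>The membership criterion behind closure under the bracket: the constant term of the trace
  vanishes.\<close>

lemma span_sl2_basis_iff:
  "A \<in> cvec.span sl2_basis \<longleftrightarrow>
     Poly_Mapping.lookup (A $ 1 $ 1) 0 + Poly_Mapping.lookup (A $ 2 $ 2) 0 = 0"
  (is "_ \<longleftrightarrow> ?tr A = 0")
proof
  assume "A \<in> cvec.span sl2_basis"
  then show "?tr A = 0"
  proof (induction rule: cvec.span_induct_alt)
    case base
    show ?case by simp
  next
    case (step c x y)
    from step(1) have "?tr x = 0"
      by (auto simp: sl2_basis_def e_mat_def f_mat_def g_mat_def h_mat_def d_mat_def mat_unit_def
          lookup_single lookup_minus when_def)
    moreover have "?tr (c *\<^sub>C x + y) = c * ?tr x + ?tr y"
      by (simp add: scaleC_vec_def scaleC_complex_def lookup_add algebra_simps)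
    ultimately show ?case using step(2) by simp
  qed
next
  assume tr: "?tr A = 0"
  let ?S = "cvec.span sl2_basis"
  let ?c = "Poly_Mapping.lookup (A $ 1 $ 1) 0"
  have sum: "mat_unit i j p = (\<Sum>k\<in>Poly_Mapping.keys p. Poly_Mapping.lookup p k *\<^sub>C mat_unit i j (basis_vec k))"
    for i j p
  proof -
    have "mat_unit i j (sum g T) = (\<Sum>k\<in>T. mat_unit i j (g k))" for g and T :: "(int \<times> int) set"
      by (induction T rule: infinite_finite_induct)
        (simp_all add: clinear_zero[OF clinear_mat_unit] clinear_add[OF clinear_mat_unit])
    then show ?thesis
      by (subst lin_ext_ident[of p, symmetric])
        (simp add: lin_ext_def clinear_scaleC[OF clinear_mat_unit])
  qed
  have off: "mat_unit 1 2 p \<in> ?S" "mat_unit 2 1 p \<in> ?S" for p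
    unfolding sum[of _ _ p]
    by (intro cvec.span_sum cvec.span_scale cvec.span_base;
        force simp: sl2_basis_def e_mat_def f_mat_def)+
  have diag: "mat_unit i i p \<in> ?S" if "Poly_Mapping.lookup p 0 = 0" for i :: 2 and p
    unfolding sum[of _ _ p]
  proof (intro cvec.span_sum cvec.span_scale cvec.span_base)
    fix k assume "k \<in> Poly_Mapping.keys p"
    then have "k \<noteq> 0" using that by (auto simp: in_keys_iff)
    then show "mat_unit i i (basis_vec k) \<in> sl2_basis"
      using exhaust_2[of i] by (auto simp: sl2_basis_def g_mat_def h_mat_def
          simp del: split_paired_Ex split_paired_All)
  qed
  have "A = mat_unit 1 2 (A $ 1 $ 2) + mat_unit 2 1 (A $ 2 $ 1)
     + mat_unit 1 1 (A $ 1 $ 1 - ?c *\<^sub>C basis_vec 0) + mat_unit 2 2 (A $ 2 $ 2 + ?c *\<^sub>C basis_vec 0)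
     + ?c *\<^sub>C d_mat"
    by (simp add: vec_eq_iff forall_2 mat_unit_def d_mat_def scaleC_vec_def)
  also have "\<dots> \<in> ?S"
    by (intro cvec.span_add cvec.span_scale off diag)
      (use tr in \<open>auto simp: lookup_minus lookup_add scaleC_complex_def add.commute sl2_basis_def
        intro: cvec.span_base\<close>)
  finally show "A \<in> ?S" .
qed

lemma qmat_bracket_in_span: "qmat_bracket q A B \<in> cvec.span sl2_basis"
  unfolding span_sl2_basis_iff qmat_bracket_def qmat_mult_def
  by (simp add: sum_2 lookup_add lookup_minus algebra_simps
      qmult_coeff_zero_commute[of q "B $ i $ j" for i j])

typedef sl2q = "cvec.span sl2_basis"
  morphisms mat_of Abs_sl2q
  using cvec.span_zero by blast

setup_lifting type_definition_sl2q

instantiation sl2q :: complex_vector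
begin
lift_definition zero_sl2q :: sl2q is 0 by (rule cvec.span_zero)
lift_definition plus_sl2q :: "sl2q \<Rightarrow> sl2q \<Rightarrow> sl2q" is "(+)" by (rule cvec.span_add)
lift_definition minus_sl2q :: "sl2q \<Rightarrow> sl2q \<Rightarrow> sl2q" is "(-)" by (rule cvec.span_diff)
lift_definition uminus_sl2q :: "sl2q \<Rightarrow> sl2q" is uminus by (rule cvec.span_neg)
lift_definition scaleC_sl2q :: "complex \<Rightarrow> sl2q \<Rightarrow> sl2q" is scaleC by (rule cvec.span_scale)
instance
  by standard (transfer; simp add: algebra_simps scaleC_add_right scaleC_add_left scaleC_one)+
end

lift_definition sl2q_bracket :: "complex \<Rightarrow> sl2q \<Rightarrow> sl2q \<Rightarrow> sl2q" is qmat_bracket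
  by (rule qmat_bracket_in_span)

text \<open>The degree derivation that multiplies the homogeneous component of degree \<open>m\<close> by \<open>\<delta> m\<close>;
  \<open>\<delta> = fst\<close> and \<open>\<delta> = snd\<close> give the actions of \<open>d\<^sub>1\<close> and \<open>d\<^sub>2\<close>.\<close>

definition qtorus_degree :: "(int \<times> int \<Rightarrow> int) \<Rightarrow> qtorus \<Rightarrow> qtorus" where
  "qtorus_degree \<delta> = lin_ext (\<lambda>m. of_int (\<delta> m) *\<^sub>C basis_vec m)"

lemma lookup_qtorus_degree:
  "Poly_Mapping.lookup (qtorus_degree \<delta> a) m = of_int (\<delta> m) * Poly_Mapping.lookup a m"
proof -
  have "Poly_Mapping.lookup (qtorus_degree \<delta> a) m =
      (\<Sum>i\<in>Poly_Mapping.keys a. if i = m then of_int (\<delta> i) * Poly_Mapping.lookup a i else 0)"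
    unfolding qtorus_degree_def lin_ext_def lookup_sum
    by (rule sum.cong) (auto simp: lookup_single scaleC_complex_def)
  then show ?thesis by (simp add: in_keys_iff)
qed

lift_definition sl2q_degree :: "(int \<times> int \<Rightarrow> int) \<Rightarrow> sl2q \<Rightarrow> sl2q"
  is "\<lambda>\<delta> A. \<chi> i j. qtorus_degree \<delta> (A $ i $ j)"
  by (simp add: span_sl2_basis_iff lookup_qtorus_degree distrib_left[symmetric])

text \<open>\<open>(z, a\<^sub>1, a\<^sub>2)\<close> stands for \<open>z + a\<^sub>1 d\<^sub>1 + a\<^sub>2 d\<^sub>2\<close>.\<close>

type_synonym sl2q_ext = "sl2q \<times> complex \<times> complex"

definition bracket :: "complex \<Rightarrow> sl2q_ext \<Rightarrow> sl2q_ext \<Rightarrow> sl2q_ext" where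
  "bracket q = (\<lambda>(z, a\<^sub>1, a\<^sub>2) (w, b\<^sub>1, b\<^sub>2).
     (sl2q_bracket q z w
        + (a\<^sub>1 *\<^sub>C sl2q_degree fst w + a\<^sub>2 *\<^sub>C sl2q_degree snd w)
        - (b\<^sub>1 *\<^sub>C sl2q_degree fst z + b\<^sub>2 *\<^sub>C sl2q_degree snd z), 0, 0))"

lemma clinear_sl2q_degree: "clinear (sl2q_degree \<delta>)"
proof (rule clinearI)
  have lin: "clinear (qtorus_degree \<delta>)"
    unfolding qtorus_degree_def by (rule clinear_lin_ext)
  note add = clinear_add[OF lin] and scaleC = clinear_scaleC[OF lin]
  fix x y :: sl2q and c :: complex
  show "sl2q_degree \<delta> (x + y) = sl2q_degree \<delta> x + sl2q_degree \<delta> y"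
    using add by transfer (simp add: vec_eq_iff)
  show "sl2q_degree \<delta> (c *\<^sub>C x) = c *\<^sub>C sl2q_degree \<delta> x"
    using scaleC by transfer (simp add: vec_eq_iff scaleC_vec_def)
qed

lemma cbilinear_sl2q_bracket: "cbilinear (sl2q_bracket q)"
  by (rule cbilinearI; transfer) (simp_all only: cbilinear_simps[OF cbilinear_qmat_bracket])

lemma cbilinear_bracket: "cbilinear (bracket q)"
  by (rule cbilinearI)
    (auto simp: bracket_def scaleC_prod_def scaleC_complex_def
      cbilinear_simps[OF cbilinear_sl2q_bracket]
      clinear_add[OF clinear_sl2q_degree] clinear_scaleC[OF clinear_sl2q_degree]
      cvec.scale_right_distrib cvec.scale_left_distrib cvec.scale_right_diff_distrib mult.commute)

section \<open>Derivations into the tensor square\<close>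

type_synonym sl2q_ext_sq = "(sl2q_ext, sl2q_ext) tensor"

definition action :: "complex \<Rightarrow> sl2q_ext \<Rightarrow> sl2q_ext_sq \<Rightarrow> sl2q_ext_sq" where
  "action q x = tensor_lift (\<lambda>a b. bracket q x a \<otimes>\<^sub>t b + a \<otimes>\<^sub>t bracket q x b)"

lemma cbilinear_action_aux: "cbilinear (\<lambda>a b. bracket q x a \<otimes>\<^sub>t b + a \<otimes>\<^sub>t bracket q x b)"
  by (rule cbilinearI)
    (simp_all add: cbilinear_simps[OF cbilinear_bracket] cbilinear_simps[OF cbilinear_tensor_of]
      scaleC_add_right)

lemma action_tensor_of:
  "action q x (a \<otimes>\<^sub>t b) = bracket q x a \<otimes>\<^sub>t b + a \<otimes>\<^sub>t bracket q x b"
  unfolding action_def by (rule tensor_lift_tensor_of[OF cbilinear_action_aux])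

lemma clinear_action: "clinear (action q x)"
  unfolding action_def by (rule clinear_tensor_lift[OF cbilinear_action_aux])

definition Der :: "complex \<Rightarrow> (sl2q_ext \<Rightarrow> sl2q_ext_sq) set" where
  "Der q = {D. clinear D \<and>
     (\<forall>x y. D (bracket q x y) = action q x (D y) - action q y (D x))}"

definition Inn :: "complex \<Rightarrow> (sl2q_ext \<Rightarrow> sl2q_ext_sq) set" where
  "Inn q = {(\<lambda>x. action q x v) | v. True}"

text \<open>The underlying set of the quotient space \<open>Der / Inn\<close>; its zero element is the coset \<open>Inn q\<close>.\<close>

definition H1 :: "complex \<Rightarrow> (sl2q_ext \<Rightarrow> sl2q_ext_sq) set set" where
  "H1 q = Der q // {(D, D'). D \<in> Der q \<and> D' \<in> Der q \<and> (\<lambda>x. D x - D' x) \<in> Inn q}"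

end

(* After subtracting an inner derivation, D preserves the weights of the torus spanned by d, d_1, d_2,
   and then it kills this torus because the tensor square has no invariants of weight zero. A further
   inner derivation makes D vanish on the copy of sl_2 in degree (0,0); only sl_2-equivariant
   components remain. The component of D(E_11 x^k) in E_12 C_q (x) E_21 C_q is a one-cocycle of
   the lattice Z^2 with values in finitely supported functions: the defect R of the cocycle rule
   satisfies R(m + l) = c R(m) with c nonzero, so R = 0. Since Z^2 has one end, the cocycle is a
   coboundary of a finitely supported function, whose product with the formal Casimir sum is a tensor
   that removes it. What is left is read off
   from the bracket of E_11 x^k - E_22 x^k with E_12 x^l: it is the inner derivation of a tensor in the
   span of the z_n (x) z_{-n} and d_i (x) d_j, where z_n = (E_11 + E_22) x^n. *)
theory Submission
  imports Defs
begin

text \<open>The obstacle is finiteness. The relations between coordinates are mostly translation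
  laws, which nonzero constant or geometric families satisfy as well; they force zero only because a
  tensor has finitely many nonzero coordinates. A second obstacle is that monomials of collinear
  degrees commute, and that elsewhere the bracket yields only the difference of the two associative
  product rules, so the cocycle rule has to be recovered by reaching degree k + 2l in two ways. The
  component E_12 (x) E_21 is singled out because left and right multiplication act on separate
  factors of it and because, by sl_2-equivariance, it controls the components E_12 (x) (E_11 - E_22)
  of the values at E_12 x^k.\<close>

lemma clinear_sum: "clinear f \<Longrightarrow> f (sum g S) = (\<Sum>i\<in>S. f (g i))"
  by (induction S rule: infinite_finite_induct) (simp_all add: clinear_zero clinear_add)

lemma clinear_eqI_basis:
  assumes "clinear f" "clinear g" "\<And>k. f (basis_vec k) = g (basis_vec k)"
  shows "f p = g p"
  by (subst (1 2) lin_ext_ident[of p, symmetric])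
    (simp add: lin_ext_def clinear_sum assms clinear_scaleC)

lemma clinear_abs_tensor: "clinear abs_tensor"
  by (rule clinearI) (simp_all add: plus_tensor.abs_eq scaleC_tensor.abs_eq)

text \<open>Scalars need no case of their own: they are absorbed into the left factor of a pure
  tensor.\<close>

lemma tensor_induct [case_names zero add tensor]:
  assumes "P 0" "\<And>x y. P x \<Longrightarrow> P y \<Longrightarrow> P (x + y)" "\<And>a b. P (a \<otimes>\<^sub>t b)"
  shows "P v"
proof -
  obtain u where v: "v = abs_tensor u"
    by (metis Quotient3_abs_rep[OF Quotient3_tensor])
  have *: "abs_tensor (basis_vec k) = fst k \<otimes>\<^sub>t snd k" for k :: "'a \<times> 'b"
    by (simp add: tensor_of.abs_eq)
  have "v = (\<Sum>k\<in>Poly_Mapping.keys u. (Poly_Mapping.lookup u k *\<^sub>C fst k) \<otimes>\<^sub>t snd k)"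
    unfolding v
    by (subst lin_ext_ident[of u, symmetric])
      (simp add: lin_ext_def clinear_sum[OF clinear_abs_tensor] clinear_scaleC[OF clinear_abs_tensor]
        cbilinear_scaleC_left[OF cbilinear_tensor_of] *)
  also have "P (\<Sum>k\<in>S. (Poly_Mapping.lookup u k *\<^sub>C fst k) \<otimes>\<^sub>t snd k)" for S
    by (induction S rule: infinite_finite_induct) (simp_all add: assms)
  finally show ?thesis .
qed

lemma clinear_minus: "clinear f \<Longrightarrow> f (- x) = - f x"
  using clinear_diff[of f 0 x] clinear_zero[of f] by simp

lemma clinear_comp: "clinear f \<Longrightarrow> clinear g \<Longrightarrow> clinear (\<lambda>x. f (g x))"
  by (rule clinearI) (simp_all add: clinear_add clinear_scaleC)

section \<open>The Lie bracket\<close>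

lemma cbilinear_diff_left: "cbilinear f \<Longrightarrow> f (x - x') y = f x y - f x' y"
  and cbilinear_diff_right: "cbilinear f \<Longrightarrow> f x (y - y') = f x y - f x y'"
  unfolding cbilinear_def by (auto dest: clinear_diff)

lemmas cbilinear_diff = cbilinear_diff_left cbilinear_diff_right

lemma qmult_assoc:
  assumes "q \<noteq> 0"
  shows "qmult q (qmult q a b) c = qmult q a (qmult q b c)"
proof (rule clinear_eqI_basis[of "\<lambda>c. qmult q (qmult q a b) c" "\<lambda>c. qmult q a (qmult q b c)"])
  note lin = cbilinear_qmult[of q, unfolded cbilinear_def]
  show "clinear (qmult q (qmult q a b))" using lin by blast
  show "clinear (\<lambda>c. qmult q a (qmult q b c))" using lin by (blast intro: clinear_comp)
  fix k
  show "qmult q (qmult q a b) (basis_vec k) = qmult q a (qmult q b (basis_vec k))"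
  proof (rule cbilinear_eqI_basis[of "\<lambda>a b. qmult q (qmult q a b) (basis_vec k)"
        "\<lambda>a b. qmult q a (qmult q b (basis_vec k))"])
    show "qmult q (qmult q (basis_vec m) (basis_vec n)) (basis_vec k) =
        qmult q (basis_vec m) (qmult q (basis_vec n) (basis_vec k))" for m n
      by (simp add: qmult_basis_vec cbilinear_simps[OF cbilinear_qmult]
          power_int_add[symmetric] assms algebra_simps)
  qed (auto intro!: cbilinearI simp: cbilinear_simps[OF cbilinear_qmult])
qed

lemma qmat_mult_assoc:
  assumes "q \<noteq> 0"
  shows "qmat_mult q (qmat_mult q A B) C = qmat_mult q A (qmat_mult q B C)"
  by (simp add: qmat_mult_def vec_eq_iff sum_2 cbilinear_simps[OF cbilinear_qmult]
      qmult_assoc[OF assms] algebra_simps)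

lemma qmat_bracket_jacobi:
  assumes "q \<noteq> 0"
  shows "qmat_bracket q (qmat_bracket q A B) C =
    qmat_bracket q A (qmat_bracket q B C) - qmat_bracket q B (qmat_bracket q A C)"
  by (simp add: qmat_bracket_def cbilinear_diff[OF cbilinear_qmat_mult] qmat_mult_assoc[OF assms])

lemma sl2q_bracket_jacobi:
  assumes "q \<noteq> 0"
  shows "sl2q_bracket q (sl2q_bracket q x y) z =
    sl2q_bracket q x (sl2q_bracket q y z) - sl2q_bracket q y (sl2q_bracket q x z)"
  using qmat_bracket_jacobi[OF assms] by transfer simp

lemma sl2q_bracket_antisym: "sl2q_bracket q x y = - sl2q_bracket q y x"
  by transfer (simp add: qmat_bracket_def)

lemma clinear_qtorus_degree: "clinear (qtorus_degree \<delta>)"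
  unfolding qtorus_degree_def by (rule clinear_lin_ext)

lemma qtorus_degree_qmult:
  assumes "\<And>m n. \<delta> (m + n) = \<delta> m + \<delta> n"
  shows "qtorus_degree \<delta> (qmult q a b) = qmult q (qtorus_degree \<delta> a) b + qmult q a (qtorus_degree \<delta> b)"
proof (rule cbilinear_eqI_basis[of "\<lambda>a b. qtorus_degree \<delta> (qmult q a b)"
      "\<lambda>a b. qmult q (qtorus_degree \<delta> a) b + qmult q a (qtorus_degree \<delta> b)"])
  have *: "qtorus_degree \<delta> (basis_vec m) = of_int (\<delta> m) *\<^sub>C basis_vec m" for m
    by (simp add: qtorus_degree_def)
  show "qtorus_degree \<delta> (qmult q (basis_vec m) (basis_vec n)) =
      qmult q (qtorus_degree \<delta> (basis_vec m)) (basis_vec n) +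
      qmult q (basis_vec m) (qtorus_degree \<delta> (basis_vec n))" for m n
    by (simp add: * qmult_basis_vec cbilinear_simps[OF cbilinear_qmult] assms
        clinear_scaleC[OF clinear_qtorus_degree] scaleC_add_left scaleC_add_right mult.commute
        distrib_left)
qed (auto intro!: cbilinearI simp: cbilinear_simps[OF cbilinear_qmult]
      clinear_add[OF clinear_qtorus_degree] clinear_scaleC[OF clinear_qtorus_degree] scaleC_add_right)

lemma sl2q_degree_bracket:
  assumes "\<And>m n. \<delta> (m + n) = \<delta> m + \<delta> n"
  shows "sl2q_degree \<delta> (sl2q_bracket q x y) =
    sl2q_bracket q (sl2q_degree \<delta> x) y + sl2q_bracket q x (sl2q_degree \<delta> y)"
  using qtorus_degree_qmult[OF assms, of q]
  by transfer (simp add: qmat_bracket_def qmat_mult_def vec_eq_iff sum_2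
      clinear_add[OF clinear_qtorus_degree] clinear_diff[OF clinear_qtorus_degree])

lemma sl2q_degree_commute:
  "sl2q_degree \<delta> (sl2q_degree \<delta>' x) = sl2q_degree \<delta>' (sl2q_degree \<delta> x)"
  by transfer (auto simp: vec_eq_iff lookup_qtorus_degree intro!: poly_mapping_eqI)

lemma bracket_jacobi:
  assumes "q \<noteq> 0"
  shows "bracket q (bracket q x y) z = bracket q x (bracket q y z) - bracket q y (bracket q x z)"
proof -
  obtain x0 x1 x2 y0 y1 y2 z0 z1 z2 where [simp]: "x = (x0, x1, x2)" "y = (y0, y1, y2)" "z = (z0, z1, z2)"
    by (metis prod_cases3)
  note [simp] = sl2q_bracket_jacobi[OF assms] cbilinear_simps[OF cbilinear_sl2q_bracket]
    cbilinear_diff[OF cbilinear_sl2q_bracket] sl2q_degree_bracket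
    clinear_add[OF clinear_sl2q_degree] clinear_diff[OF clinear_sl2q_degree]
    clinear_scaleC[OF clinear_sl2q_degree] cvec.scale_right_diff_distrib scaleC_add_right scaleC_scaleC
    sl2q_degree_commute[of snd fst]
  have 1: "sl2q_bracket q (sl2q_degree \<delta> v) w = - sl2q_bracket q w (sl2q_degree \<delta> v)" for \<delta> v w
    by (rule sl2q_bracket_antisym)
  show ?thesis
    by (simp add: bracket_def 1 zero_prod_def algebra_simps)
qed

lemma action_bracket:
  assumes "q \<noteq> 0"
  shows "action q (bracket q x y) v = action q x (action q y v) - action q y (action q x v)"
  by (induction v rule: tensor_induct)
    (simp_all add: clinear_zero[OF clinear_action] clinear_add[OF clinear_action] action_tensor_of
      bracket_jacobi[OF assms] cbilinear_diff[OF cbilinear_tensor_of])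

lemma action_add: "action q (x + y) v = action q x v + action q y v"
  by (induction v rule: tensor_induct)
    (simp_all add: clinear_zero[OF clinear_action] clinear_add[OF clinear_action] action_tensor_of
      cbilinear_simps[OF cbilinear_bracket] cbilinear_simps[OF cbilinear_tensor_of])

lemma action_scaleC: "action q (c *\<^sub>C x) v = c *\<^sub>C action q x v"
  by (induction v rule: tensor_induct)
    (simp_all add: clinear_zero[OF clinear_action] clinear_add[OF clinear_action] action_tensor_of
      cbilinear_simps[OF cbilinear_bracket] cbilinear_simps[OF cbilinear_tensor_of] scaleC_add_right)

lemma Inn_subset_Der:
  assumes "q \<noteq> 0"
  shows "Inn q \<subseteq> Der q"
proof
  fix D assume "D \<in> Inn q"
  then obtain v where D: "D = (\<lambda>x. action q x v)" by (auto simp: Inn_def)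
  have "clinear D" unfolding D by (rule clinearI) (simp_all only: action_add action_scaleC)
  then show "D \<in> Der q" by (simp only: Der_def mem_Collect_eq D action_bracket[OF assms]) simp
qed

lemma Der_clinear: "D \<in> Der q \<Longrightarrow> clinear D"
  unfolding Der_def by blast

lemma Der_bracket: "D \<in> Der q \<Longrightarrow> D (bracket q x y) = action q x (D y) - action q y (D x)"
  unfolding Der_def by blast

lemma Der_diff:
  assumes "D \<in> Der q" "D' \<in> Der q"
  shows "(\<lambda>x. D x - D' x) \<in> Der q"
proof -
  have "clinear (\<lambda>x. D x - D' x)"
    by (rule clinearI) (simp_all add: clinear_add[OF assms(1)[THEN Der_clinear]]
        clinear_add[OF assms(2)[THEN Der_clinear]] clinear_scaleC[OF assms(1)[THEN Der_clinear]]
        clinear_scaleC[OF assms(2)[THEN Der_clinear]] cvec.scale_right_diff_distrib)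
  moreover have "D (bracket q x y) - D' (bracket q x y) =
      action q x (D y - D' y) - action q y (D x - D' x)" for x y
    by (simp add: Der_bracket[OF assms(1)] Der_bracket[OF assms(2)] clinear_diff[OF clinear_action])
  ultimately show ?thesis unfolding Der_def by blast
qed

section \<open>Coordinates\<close>

text \<open>\<open>Hv m\<close> and \<open>Zv m\<close> stand for the difference and the sum of \<open>g_mat m\<close> and \<open>h_mat m\<close>;
  \<open>Zv 0\<close> is a dummy index whose vector and coordinate are zero.\<close>

datatype ix = Ev "int \<times> int" | Fv "int \<times> int" | Hv "int \<times> int" | Zv "int \<times> int" | D1 | D2

text \<open>A square root \<open>p\<close> of \<open>q\<close> is fixed because the symmetric
  normalization of monomials needs half powers of \<open>q\<close>; the twists then depend only on
  the determinant of two degrees.\<close>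

locale quantum_torus_root =
  fixes p q :: complex
  assumes q_def: "q = p * p" and p_nonzero: "p \<noteq> 0"
    and p_not_root: "\<And>n::nat. n > 0 \<Longrightarrow> p ^ n \<noteq> 1"
begin

lemma q_nonzero: "q \<noteq> 0"
  by (simp add: q_def p_nonzero)

lemma p_powi_eq_1_iff: "p powi i = 1 \<longleftrightarrow> i = 0"
proof
  assume *: "p powi i = 1"
  show "i = 0"
  proof (rule ccontr)
    assume "i \<noteq> 0"
    then have "nat \<bar>i\<bar> > 0" by simp
    moreover have "p ^ nat \<bar>i\<bar> = 1"
      using * by (cases "i \<ge> 0") (auto simp: power_int_def field_simps)
    ultimately show False using p_not_root by blast
  qed
qed simp

text \<open>With \<open>X\<^sup>m = p ^ (m\<^sub>1 m\<^sub>2) x ^ m\<^sub>1 y ^ m\<^sub>2\<close> the product of the quantum torus becomes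
  \<open>X\<^sup>k X\<^sup>m = tw k m X\<^sup>(\<^sup>k\<^sup>+\<^sup>m\<^sup>)\<close>, where \<open>tw m k\<close> is the inverse of \<open>tw k m\<close>. Then \<open>sq\<close> and \<open>cq\<close>
  are the coefficients of commutators and anticommutators. All coordinates refer to the \<open>X\<^sup>m\<close>.\<close>

definition tw :: "int \<times> int \<Rightarrow> int \<times> int \<Rightarrow> complex" where
  "tw k m = p powi (snd k * fst m - fst k * snd m)"

definition sq :: "int \<times> int \<Rightarrow> int \<times> int \<Rightarrow> complex" where "sq k m = tw k m - tw m k"
definition cq :: "int \<times> int \<Rightarrow> int \<times> int \<Rightarrow> complex" where "cq k m = tw k m + tw m k"

lemma tw_nonzero [simp]: "tw k m \<noteq> 0"
  by (simp add: tw_def p_nonzero power_int_eq_0_iff)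

lemma tw_zero [simp]: "tw 0 m = 1" "tw m 0 = 1" and tw_self [simp]: "tw m m = 1"
  by (simp_all add: tw_def mult.commute)

lemma tw_add_left: "tw (k + l) m = tw k m * tw l m"
  and tw_add_right: "tw m (k + l) = tw m k * tw m l"
  by (simp_all add: tw_def p_nonzero power_int_add[symmetric] algebra_simps)

lemma tw_commute: "tw m k = inverse (tw k m)"
  by (simp add: tw_def power_int_minus[symmetric] algebra_simps)

lemma tw_uminus_left: "tw (- k) m = inverse (tw k m)"
  and tw_uminus_right: "tw m (- k) = inverse (tw m k)"
  by (simp_all add: tw_def power_int_minus[symmetric])

lemma tw_diff_left: "tw (k - l) m = tw k m * inverse (tw l m)"
  and tw_diff_right: "tw m (k - l) = tw m k * inverse (tw m l)"
  using tw_add_left[of k "- l" m] tw_add_right[of m k "- l"]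
  by (simp_all add: tw_uminus_left tw_uminus_right)

lemmas tw_simps = tw_add_left tw_add_right tw_diff_left tw_diff_right tw_uminus_left tw_uminus_right

lemma tw_double_eq_1_iff: "tw k m * tw k m = 1 \<longleftrightarrow> snd k * fst m = fst k * snd m"
  by (simp add: tw_def p_nonzero power_int_add[symmetric] p_powi_eq_1_iff algebra_simps)

text \<open>As \<open>p\<close> is not a root of unity, the square of \<open>tw k m\<close> is 1
  only for exponent zero: only collinear degrees commute.\<close>

lemma sq_eq_0_iff: "sq k m = 0 \<longleftrightarrow> snd k * fst m = fst k * snd m"
proof -
  have "sq k m = 0 \<longleftrightarrow> tw k m * tw k m = 1"
    by (simp add: sq_def tw_commute[of m k] field_simps)
  then show ?thesis by (simp only: tw_double_eq_1_iff)
qed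

text \<open>A zero would make \<open>tw k m\<close> a primitive fourth root of unity, yet 1 is the
  only root of unity among the integral powers of \<open>p\<close>. Anticommutator coefficients can
  thus always be cancelled.\<close>

lemma cq_nonzero [simp]: "cq k m \<noteq> 0"
proof
  assume "cq k m = 0"
  then have *: "tw k m * tw k m = -1"
    by (simp add: cq_def tw_commute[of m k] field_simps add_eq_0_iff)
  have "p powi (4 * (snd k * fst m - fst k * snd m)) = (tw k m * tw k m) * (tw k m * tw k m)"
    by (simp add: tw_def p_nonzero power_int_add[symmetric] algebra_simps)
  then have "4 * (snd k * fst m - fst k * snd m) = 0"
    unfolding * by (simp add: p_powi_eq_1_iff del: mult_eq_0_iff)
  then have "tw k m = 1" by (simp add: tw_def)
  then show False using * by simp
qed

lemma sq_commute: "sq m k = - sq k m"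
  by (simp add: sq_def)

lemma sq_simps [simp]: "sq m m = 0" "sq 0 m = 0" "sq m 0 = 0" "cq m m = 2" "cq 0 m = 2" "cq m 0 = 2"
  by (simp_all add: sq_def cq_def)

lemma ex_sq_nonzero: "m \<noteq> 0 \<Longrightarrow> sq (1, 0) m \<noteq> 0 \<or> sq (0, 1) m \<noteq> 0"
  by (auto simp: sq_eq_0_iff prod_eq_iff)

definition nrm :: "int \<times> int \<Rightarrow> complex" where "nrm m = p powi (fst m * snd m)"

lemma nrm_nonzero [simp]: "nrm m \<noteq> 0"
  by (simp add: nrm_def p_nonzero power_int_eq_0_iff)

definition entry :: "2 \<Rightarrow> 2 \<Rightarrow> int \<times> int \<Rightarrow> sl2q_ext \<Rightarrow> complex" where
  "entry i j m y = Poly_Mapping.lookup (mat_of (fst y) $ i $ j) m / nrm m"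

fun kap :: "ix \<Rightarrow> sl2q_ext \<Rightarrow> complex" where
  "kap (Ev m) y = entry 1 2 m y"
| "kap (Fv m) y = entry 2 1 m y"
| "kap (Hv m) y = (entry 1 1 m y - entry 2 2 m y) / 2"
| "kap (Zv m) y = (entry 1 1 m y + entry 2 2 m y) / 2"
| "kap D1 y = fst (snd y)"
| "kap D2 y = snd (snd y)"

fun bas_mat :: "ix \<Rightarrow> qmat" where
  "bas_mat (Ev m) = nrm m *\<^sub>C e_mat m"
| "bas_mat (Fv m) = nrm m *\<^sub>C f_mat m"
| "bas_mat (Hv m) = nrm m *\<^sub>C (g_mat m - h_mat m)"
| "bas_mat (Zv m) = (if m = 0 then 0 else nrm m *\<^sub>C (g_mat m + h_mat m))"
| "bas_mat D1 = 0"
| "bas_mat D2 = 0"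

definition bas :: "ix \<Rightarrow> sl2q_ext" where
  "bas b = (Abs_sl2q (bas_mat b), of_bool (b = D1), of_bool (b = D2))"

lemmas mat_defs = e_mat_def f_mat_def g_mat_def h_mat_def mat_unit_def scaleC_vec_def

lemma bas_mat_in_span: "bas_mat b \<in> cvec.span sl2_basis"
  by (cases b) (auto simp: span_sl2_basis_iff mat_defs lookup_single lookup_minus lookup_add
      scaleC_complex_def)

lemma mat_of_bas: "mat_of (fst (bas b)) = bas_mat b"
  by (simp add: bas_def Abs_sl2q_inverse bas_mat_in_span)

lemma kap_bas: "kap c (bas b) = of_bool (c = b \<and> b \<noteq> Zv 0)"
  by (cases c; cases b) (auto simp: entry_def mat_of_bas mat_defs lookup_single lookup_minus lookup_add
      scaleC_complex_def when_def, simp_all add: bas_def)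

lemma entry_add: "entry i j m (x + y) = entry i j m x + entry i j m y"
  by (simp add: entry_def plus_sl2q.rep_eq lookup_add add_divide_distrib)

lemma entry_scaleC: "entry i j m (c *\<^sub>C x) = c * entry i j m x"
  by (simp add: entry_def scaleC_sl2q.rep_eq scaleC_prod_def scaleC_vec_def scaleC_complex_def)

lemma clinear_kap: "clinear (kap b)"
  by (rule clinearI; cases b) (simp_all add: entry_add entry_scaleC scaleC_complex_def field_simps,
      simp_all add: scaleC_prod_def scaleC_complex_def)

lemma kap_trace: "kap (Zv 0) y = 0"
  using mat_of[of "fst y"] by (simp add: span_sl2_basis_iff entry_def nrm_def)

lemma kap_eqI:
  assumes "\<And>b. kap b x = kap b y"
  shows "x = y"
proof -
  have "mat_of (fst x) $ i $ j = mat_of (fst y) $ i $ j" for i j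
  proof (rule poly_mapping_eqI)
    fix m
    note a = assms[of "Ev m"] assms[of "Fv m"] assms[of "Hv m"] assms[of "Zv m"]
    have "entry 1 1 m z = kap (Hv m) z + kap (Zv m) z" "entry 2 2 m z = kap (Zv m) z - kap (Hv m) z" for z
      by (simp_all add: field_simps)
    then have "entry 1 1 m x = entry 1 1 m y" "entry 2 2 m x = entry 2 2 m y"
      using a by (simp_all del: kap.simps)
    then have "entry i j m x = entry i j m y"
      using exhaust_2[of i] exhaust_2[of j] a(1,2) by auto
    then show "Poly_Mapping.lookup (mat_of (fst x) $ i $ j) m = Poly_Mapping.lookup (mat_of (fst y) $ i $ j) m"
      by (simp add: entry_def)
  qed
  then have "mat_of (fst x) = mat_of (fst y)" by (simp add: vec_eq_iff)
  then have "fst x = fst y" by (simp add: mat_of_inject)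
  moreover have "snd x = snd y"
    using assms[of D1] assms[of D2] by (simp add: prod_eq_iff)
  ultimately show ?thesis by (simp add: prod_eq_iff)
qed

lemma finite_kap: "finite {b. kap b y \<noteq> 0}"
proof -
  let ?K = "\<Union>i j. Poly_Mapping.keys (mat_of (fst y) $ i $ j)"
  have "{b. kap b y \<noteq> 0} \<subseteq> Ev ` ?K \<union> Fv ` ?K \<union> Hv ` ?K \<union> Zv ` ?K \<union> {D1, D2}"
  proof
    fix b assume "b \<in> {b. kap b y \<noteq> 0}"
    then have *: "kap b y \<noteq> 0" by simp
    have key: "m \<in> ?K" if "entry i j m y \<noteq> 0" for i j m
      using that by (auto simp: entry_def in_keys_iff)
    show "b \<in> Ev ` ?K \<union> Fv ` ?K \<union> Hv ` ?K \<union> Zv ` ?K \<union> {D1, D2}"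
    proof (cases b)
      case (Ev m)
      then show ?thesis using key[of 1 2 m] * by (simp del: UN_iff)
    next
      case (Fv m)
      then show ?thesis using key[of 2 1 m] * by (simp del: UN_iff)
    next
      case case_m: (Hv m)
      then have "entry 1 1 m y \<noteq> 0 \<or> entry 2 2 m y \<noteq> 0" using * by auto
      then have "m \<in> ?K" using key by blast
      then show ?thesis by (simp add: case_m del: UN_iff)
    next
      case case_m: (Zv m)
      then have "entry 1 1 m y \<noteq> 0 \<or> entry 2 2 m y \<noteq> 0" using * by auto
      then have "m \<in> ?K" using key by blast
      then show ?thesis by (simp add: case_m del: UN_iff)
    qed simp_all
  qed
  then show ?thesis by (rule finite_subset) simp
qed

lemma kap_expansion:
  assumes "finite S" "\<And>b. kap b y \<noteq> 0 \<Longrightarrow> b \<in> S"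
  shows "y = (\<Sum>b\<in>S. kap b y *\<^sub>C bas b)"
proof (rule kap_eqI)
  fix c
  have "kap c (\<Sum>b\<in>S. kap b y *\<^sub>C bas b) = (\<Sum>b\<in>S. if b = c then kap c y else 0)"
    unfolding clinear_sum[OF clinear_kap]
    by (rule sum.cong) (auto simp: clinear_scaleC[OF clinear_kap] kap_bas scaleC_complex_def kap_trace
        simp del: kap.simps)
  then show "kap c y = kap c (\<Sum>b\<in>S. kap b y *\<^sub>C bas b)"
    using assms by (auto simp: sum.delta)
qed

section \<open>The coadjoint action in coordinates\<close>

text \<open>The eigenvalue on degree \<open>k\<close> of the d_1, d_2 part of an element with
  coordinates \<open>\<phi>\<close>.\<close>

definition dg :: "int \<times> int \<Rightarrow> (ix \<Rightarrow> complex) \<Rightarrow> complex" where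
  "dg k \<phi> = of_int (fst k) * \<phi> D1 + of_int (snd k) * \<phi> D2"

lemma dg_0: "(if a = 0 then dg 0 \<phi> else 0) = 0"
  by (simp add: dg_def)

fun deg :: "ix \<Rightarrow> int \<times> int" where
  "deg (Ev m) = m" | "deg (Fv m) = m" | "deg (Hv m) = m" | "deg (Zv m) = m" | "deg D1 = 0" | "deg D2 = 0"

text \<open>Row \<open>b\<close> of the matrix of ad \<open>bas x\<close>, applied to a family of
  coordinates. Taking families instead of elements lets it act on one index of a tensor while the
  other is fixed.\<close>

fun coad :: "ix \<Rightarrow> ix \<Rightarrow> (ix \<Rightarrow> complex) \<Rightarrow> complex" where
  "coad (Ev k) (Ev m) \<phi> =
     - cq k m * \<phi> (Hv (m - k)) + sq k m * \<phi> (Zv (m - k)) - (if m = k then dg k \<phi> else 0)"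
| "coad (Ev k) (Hv m) \<phi> = cq k m / 2 * \<phi> (Fv (m - k))"
| "coad (Ev k) (Zv m) \<phi> = sq k m / 2 * \<phi> (Fv (m - k))"
| "coad (Fv k) (Fv m) \<phi> =
     cq k m * \<phi> (Hv (m - k)) + sq k m * \<phi> (Zv (m - k)) - (if m = k then dg k \<phi> else 0)"
| "coad (Fv k) (Hv m) \<phi> = - cq k m / 2 * \<phi> (Ev (m - k))"
| "coad (Fv k) (Zv m) \<phi> = sq k m / 2 * \<phi> (Ev (m - k))"
| "coad (Hv k) (Ev m) \<phi> = cq k m * \<phi> (Ev (m - k))"
| "coad (Hv k) (Fv m) \<phi> = - cq k m * \<phi> (Fv (m - k))"
| "coad (Hv k) (Hv m) \<phi> = sq k m * \<phi> (Zv (m - k)) - (if m = k then dg k \<phi> else 0)"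
| "coad (Hv k) (Zv m) \<phi> = sq k m * \<phi> (Hv (m - k))"
| "coad (Zv k) (Ev m) \<phi> = sq k m * \<phi> (Ev (m - k))"
| "coad (Zv k) (Fv m) \<phi> = sq k m * \<phi> (Fv (m - k))"
| "coad (Zv k) (Hv m) \<phi> = sq k m * \<phi> (Hv (m - k))"
| "coad (Zv k) (Zv m) \<phi> = sq k m * \<phi> (Zv (m - k)) - (if m = k then dg k \<phi> else 0)"
| "coad D1 b \<phi> = of_int (fst (deg b)) * \<phi> b"
| "coad D2 b \<phi> = of_int (snd (deg b)) * \<phi> b"
| "coad _ _ \<phi> = 0"

lemma lookup_qmult_left:
  "Poly_Mapping.lookup (qmult q (c *\<^sub>C basis_vec k) a) m =
    c * q powi (snd k * (fst m - fst k)) * Poly_Mapping.lookup a (m - k)"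
proof (rule clinear_eqI_basis[of "\<lambda>a. Poly_Mapping.lookup (qmult q (c *\<^sub>C basis_vec k) a) m"])
  show "Poly_Mapping.lookup (qmult q (c *\<^sub>C basis_vec k) (basis_vec n)) m =
      c * q powi (snd k * (fst m - fst k)) * Poly_Mapping.lookup (basis_vec n) (m - k)" for n
    by (auto simp: cbilinear_simps[OF cbilinear_qmult] qmult_basis_vec lookup_single when_def
        scaleC_complex_def)
qed (auto intro!: clinearI simp: cbilinear_simps[OF cbilinear_qmult] lookup_add scaleC_complex_def
    algebra_simps)

lemma lookup_qmult_right:
  "Poly_Mapping.lookup (qmult q a (c *\<^sub>C basis_vec k)) m =
    c * q powi ((snd m - snd k) * fst k) * Poly_Mapping.lookup a (m - k)"
proof (rule clinear_eqI_basis[of "\<lambda>a. Poly_Mapping.lookup (qmult q a (c *\<^sub>C basis_vec k)) m"])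
  show "Poly_Mapping.lookup (qmult q (basis_vec n) (c *\<^sub>C basis_vec k)) m =
      c * q powi ((snd m - snd k) * fst k) * Poly_Mapping.lookup (basis_vec n) (m - k)" for n
    by (auto simp: cbilinear_simps[OF cbilinear_qmult] qmult_basis_vec lookup_single when_def
        scaleC_complex_def)
qed (auto intro!: clinearI simp: cbilinear_simps[OF cbilinear_qmult] lookup_add scaleC_complex_def
    algebra_simps)

lemma qmult_zero [simp]: "qmult q 0 a = 0" "qmult q a 0 = 0"
  using cbilinear_qmult[of q] by (auto simp: cbilinear_def dest: clinear_zero)

lemma qmult_uminus [simp]: "qmult q (- a) b = - qmult q a b" "qmult q a (- b) = - qmult q a b"
  using cbilinear_diff[OF cbilinear_qmult, of q 0] cbilinear_diff[OF cbilinear_qmult, of q a 0] by simp_all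

lemma lookup_qmult_nrm:
  "Poly_Mapping.lookup (qmult q (nrm k *\<^sub>C basis_vec k) a) m =
    nrm m * (tw k m * (Poly_Mapping.lookup a (m - k) / nrm (m - k)))"
  "Poly_Mapping.lookup (qmult q a (nrm k *\<^sub>C basis_vec k)) m =
    nrm m * (tw m k * (Poly_Mapping.lookup a (m - k) / nrm (m - k)))"
proof -
  have q: "q powi i = p powi (2 * i)" for i
    using power_int_mult[of p 2 i] by (simp add: q_def power2_eq_square)
  have "nrm k * q powi (snd k * (fst m - fst k)) * nrm (m - k) = tw k m * nrm m"
    "nrm k * q powi ((snd m - snd k) * fst k) * nrm (m - k) = tw m k * nrm m"
    by (simp_all add: q nrm_def tw_def p_nonzero power_int_add[symmetric] algebra_simps)
  then have *: "nrm k * q powi (snd k * (fst m - fst k)) = tw k m * nrm m / nrm (m - k)"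
    "nrm k * q powi ((snd m - snd k) * fst k) = tw m k * nrm m / nrm (m - k)"
    by (simp_all add: eq_divide_eq)
  show "Poly_Mapping.lookup (qmult q (nrm k *\<^sub>C basis_vec k) a) m =
      nrm m * (tw k m * (Poly_Mapping.lookup a (m - k) / nrm (m - k)))"
    "Poly_Mapping.lookup (qmult q a (nrm k *\<^sub>C basis_vec k)) m =
      nrm m * (tw m k * (Poly_Mapping.lookup a (m - k) / nrm (m - k)))"
    by (simp_all add: lookup_qmult_left lookup_qmult_right *)
qed

lemma entry_bracket:
  "entry i j m (bracket q x y) =
    (\<Sum>l\<in>UNIV. Poly_Mapping.lookup (qmult q (mat_of (fst x) $ i $ l) (mat_of (fst y) $ l $ j)) m / nrm m
      - Poly_Mapping.lookup (qmult q (mat_of (fst y) $ i $ l) (mat_of (fst x) $ l $ j)) m / nrm m)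
    + (of_int (fst m) * kap D1 x + of_int (snd m) * kap D2 x) * entry i j m y
    - (of_int (fst m) * kap D1 y + of_int (snd m) * kap D2 y) * entry i j m x"
  by (cases x; cases y) (simp add: entry_def bracket_def sl2q_bracket.rep_eq plus_sl2q.rep_eq
      minus_sl2q.rep_eq scaleC_sl2q.rep_eq sl2q_degree.rep_eq qmat_bracket_def qmat_mult_def sum_2
      lookup_add lookup_minus scaleC_vec_def lookup_qtorus_degree scaleC_complex_def
      diff_divide_distrib add_divide_distrib algebra_simps)

lemma kap_bracket_D: "kap D1 (bracket q x y) = 0" "kap D2 (bracket q x y) = 0"
  by (cases x; cases y; simp add: bracket_def)+

lemma bas_mat_nth:
  "bas_mat (Ev k) $ 1 $ 2 = nrm k *\<^sub>C basis_vec k" "bas_mat (Ev k) $ 1 $ 1 = 0"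
  "bas_mat (Ev k) $ 2 $ 1 = 0" "bas_mat (Ev k) $ 2 $ 2 = 0"
  "bas_mat (Fv k) $ 2 $ 1 = nrm k *\<^sub>C basis_vec k" "bas_mat (Fv k) $ 1 $ 1 = 0"
  "bas_mat (Fv k) $ 1 $ 2 = 0" "bas_mat (Fv k) $ 2 $ 2 = 0"
  "bas_mat (Hv k) $ 1 $ 1 = nrm k *\<^sub>C basis_vec k" "bas_mat (Hv k) $ 1 $ 2 = 0"
  "bas_mat (Hv k) $ 2 $ 1 = 0" "bas_mat (Hv k) $ 2 $ 2 = (- nrm k) *\<^sub>C basis_vec k"
  "bas_mat (Zv k) $ 1 $ 1 = (if k = 0 then 0 else nrm k) *\<^sub>C basis_vec k" "bas_mat (Zv k) $ 1 $ 2 = 0"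
  "bas_mat (Zv k) $ 2 $ 1 = 0" "bas_mat (Zv k) $ 2 $ 2 = (if k = 0 then 0 else nrm k) *\<^sub>C basis_vec k"
  by (auto simp: mat_defs)

lemma entry_bas:
  "entry i j m (bas b) = Poly_Mapping.lookup (bas_mat b $ i $ j) m / nrm m"
  by (simp add: entry_def mat_of_bas)

lemma kap_bracket: "kap b (bracket q (bas x) y) = coad x b (\<lambda>c. kap c y)"
proof -
  have D: "kap D1 (bas x) = of_bool (x = D1)" "kap D2 (bas x) = of_bool (x = D2)" for x
    by (simp_all add: bas_def)
  have e: "Poly_Mapping.lookup (mat_of (fst y) $ i $ j) m / nrm m = entry i j m y" for i j m
    by (simp add: entry_def)
  show ?thesis
    by (cases x; cases b;
      simp add: entry_bracket D sum_2 mat_of_bas bas_mat_nth lookup_qmult_nrm e entry_bas kap_bracket_D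
        sq_def cq_def dg_def lookup_single when_def scaleC_complex_def algebra_simps add_divide_distrib
        diff_divide_distrib
        del: kap.simps(5,6) bas_mat.simps(1-4) split_paired_All split_paired_Ex)
qed

section \<open>Coordinates on the tensor square\<close>

definition K :: "ix \<Rightarrow> ix \<Rightarrow> sl2q_ext_sq \<Rightarrow> complex" where
  "K b b' = tensor_lift (\<lambda>x y. kap b x * kap b' y)"

lemma cbilinear_kap_mult: "cbilinear (\<lambda>x y. kap b x * kap b' y)"
  by (rule cbilinearI) (simp_all only: clinear_add[OF clinear_kap] clinear_scaleC[OF clinear_kap]
      scaleC_complex_def distrib_left distrib_right mult.left_commute mult.assoc)

lemma clinear_K: "clinear (K b b')"
  unfolding K_def by (rule clinear_tensor_lift[OF cbilinear_kap_mult])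

lemma K_tensor: "K b b' (x \<otimes>\<^sub>t y) = kap b x * kap b' y"
  unfolding K_def by (rule tensor_lift_tensor_of[OF cbilinear_kap_mult])

lemma K_simps [simp]:
  "K b b' 0 = 0" "K b b' (u + v) = K b b' u + K b b' v" "K b b' (u - v) = K b b' u - K b b' v"
  "K b b' (c *\<^sub>C v) = c * K b b' v"
  by (simp_all add: clinear_zero[OF clinear_K] clinear_add[OF clinear_K] clinear_diff[OF clinear_K]
      clinear_scaleC[OF clinear_K] scaleC_complex_def)

lemma K_trace [simp]: "K (Zv 0) b v = 0" "K b (Zv 0) v = 0"
  by (induction v rule: tensor_induct; simp add: K_tensor kap_trace del: kap.simps)+

text \<open>The source of the vanishing arguments: a coordinate that cannot vanish at one index
  without vanishing along an infinite family must vanish.\<close>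

lemma finite_K: "finite {(b, b'). K b b' v \<noteq> 0}"
proof (induction v rule: tensor_induct)
  case (add x y)
  then show ?case by (rule finite_subset[rotated, OF finite_UnI]) auto
next
  case (tensor a b)
  have "{(c, c'). K c c' (a \<otimes>\<^sub>t b) \<noteq> 0} \<subseteq> {c. kap c a \<noteq> 0} \<times> {c. kap c b \<noteq> 0}"
    by (auto simp: K_tensor simp del: kap.simps)
  then show ?case by (rule finite_subset) (simp add: finite_kap)
qed simp

text \<open>Allowing every finite superset \<open>T\<close> lets the induction treat a sum of
  tensors with the union of the two index sets.\<close>

lemma K_expansion:
  "\<exists>S. finite S \<and> (\<forall>T. finite T \<longrightarrow> S \<subseteq> T \<longrightarrow>
     v = (\<Sum>b\<in>T. \<Sum>b'\<in>T. K b b' v *\<^sub>C (bas b \<otimes>\<^sub>t bas b')))"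
proof (induction v rule: tensor_induct)
  case (add x y)
  then obtain S S' where *: "finite S" "finite S'"
    "\<And>T. finite T \<Longrightarrow> S \<subseteq> T \<Longrightarrow> x = (\<Sum>b\<in>T. \<Sum>b'\<in>T. K b b' x *\<^sub>C (bas b \<otimes>\<^sub>t bas b'))"
    "\<And>T. finite T \<Longrightarrow> S' \<subseteq> T \<Longrightarrow> y = (\<Sum>b\<in>T. \<Sum>b'\<in>T. K b b' y *\<^sub>C (bas b \<otimes>\<^sub>t bas b'))"
    by blast
  show ?case
  proof (intro exI[of _ "S \<union> S'"] conjI allI impI)
    fix T assume T: "finite T" "S \<union> S' \<subseteq> T"
    then show "x + y = (\<Sum>b\<in>T. \<Sum>b'\<in>T. K b b' (x + y) *\<^sub>C (bas b \<otimes>\<^sub>t bas b'))"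
      by (subst *(3)[of T], simp_all, subst *(4)[of T], simp_all add: scaleC_add_left sum.distrib)
  qed (use * in simp)
next
  case (tensor x y)
  let ?S = "{b. kap b x \<noteq> 0} \<union> {b. kap b y \<noteq> 0}"
  have left: "sum g A \<otimes>\<^sub>t z = (\<Sum>b\<in>A. g b \<otimes>\<^sub>t z)" for g and A :: "ix set" and z :: sl2q_ext
    using clinear_sum[of "\<lambda>x. x \<otimes>\<^sub>t z"] cbilinear_tensor_of by (auto simp: cbilinear_def)
  have right: "z \<otimes>\<^sub>t sum g A = (\<Sum>b\<in>A. z \<otimes>\<^sub>t g b)" for g and A :: "ix set" and z :: sl2q_ext
    using clinear_sum[of "(\<otimes>\<^sub>t) z"] cbilinear_tensor_of by (auto simp: cbilinear_def)
  show ?case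
  proof (intro exI[of _ ?S] conjI allI impI)
    fix T assume T: "finite T" "?S \<subseteq> T"
    have "x = (\<Sum>b\<in>T. kap b x *\<^sub>C bas b)" "y = (\<Sum>b\<in>T. kap b y *\<^sub>C bas b)"
      using T by (intro kap_expansion; blast)+
    then have "x \<otimes>\<^sub>t y = (\<Sum>b\<in>T. kap b x *\<^sub>C bas b) \<otimes>\<^sub>t (\<Sum>b\<in>T. kap b y *\<^sub>C bas b)"
      by metis
    also have "\<dots> = (\<Sum>b\<in>T. \<Sum>b'\<in>T. K b b' (x \<otimes>\<^sub>t y) *\<^sub>C (bas b \<otimes>\<^sub>t bas b'))"
      unfolding left by (simp add: right K_tensor cbilinear_simps[OF cbilinear_tensor_of]
          cvec.scale_sum_right mult.commute del: kap.simps)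
    finally show "x \<otimes>\<^sub>t y = (\<Sum>b\<in>T. \<Sum>b'\<in>T. K b b' (x \<otimes>\<^sub>t y) *\<^sub>C (bas b \<otimes>\<^sub>t bas b'))" .
  qed (simp add: finite_kap del: kap.simps)
qed auto

lemma K_zeroI:
  assumes "\<And>b b'. K b b' v = 0"
  shows "v = 0"
  using K_expansion[of v] assms by auto

lemma ex_tensor:
  assumes "finite S" "\<And>b b'. (b, b') \<notin> S \<Longrightarrow> F b b' = 0"
    and "\<And>b. F (Zv 0) b = 0" "\<And>b. F b (Zv 0) = 0"
  obtains v where "\<And>b b'. K b b' v = F b b'"
proof
  fix b b'
  have "K b b' (\<Sum>c\<in>S. F (fst c) (snd c) *\<^sub>C (bas (fst c) \<otimes>\<^sub>t bas (snd c))) =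
      (\<Sum>c\<in>S. if c = (b, b') then F b b' else 0)"
    unfolding clinear_sum[OF clinear_K]
    by (rule sum.cong) (auto simp: K_tensor kap_bas assms(3,4) prod_eq_iff simp del: kap.simps)
  also have "\<dots> = F b b'" using assms(1,2) by (simp add: sum.delta)
  finally show "K b b' (\<Sum>c\<in>S. F (fst c) (snd c) *\<^sub>C (bas (fst c) \<otimes>\<^sub>t bas (snd c))) = F b b'" .
qed

lemma coad_add: "coad x b (\<lambda>c. \<phi> c + \<psi> c) = coad x b \<phi> + coad x b \<psi>"
  by (cases x; cases b) (simp_all add: dg_def algebra_simps)

lemma coad_mult: "coad x b (\<lambda>c. a * \<phi> c) = a * coad x b \<phi>"
  by (cases x; cases b) (simp_all add: dg_def algebra_simps)

lemma coad_mult_right: "coad x b (\<lambda>c. \<phi> c * a) = coad x b \<phi> * a"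
  using coad_mult[of x b a \<phi>] by (simp add: mult.commute)

lemma coad_zero: "coad x b (\<lambda>c. 0) = 0"
  using coad_mult[of x b 0] by simp

lemma K_action:
  "K b b' (action q (bas x) v) = coad x b (\<lambda>c. K c b' v) + coad x b' (\<lambda>c. K b c v)"
  by (induction v rule: tensor_induct)
    (simp_all add: clinear_zero[OF clinear_action] clinear_add[OF clinear_action] action_tensor_of
      K_tensor coad_zero coad_add coad_mult coad_mult_right kap_bracket del: kap.simps)

fun wt :: "ix \<Rightarrow> int" where
  "wt (Ev m) = 1" | "wt (Fv m) = - 1" | "wt _ = 0"

lemma coad_weight:
  assumes "\<And>c. wt c = wt b - wt x \<Longrightarrow> deg c = deg b - deg x \<Longrightarrow> \<phi> c = 0"
  shows "coad x b \<phi> = 0"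
  by (cases x; cases b) (simp_all add: assms dg_def)

lemma coad_torus:
  "coad D1 b \<phi> = of_int (fst (deg b)) * \<phi> b" "coad D2 b \<phi> = of_int (snd (deg b)) * \<phi> b"
  "coad (Hv 0) b \<phi> = of_int (2 * wt b) * \<phi> b"
  by (cases b; simp add: dg_def)+

section \<open>The bracket on the basis\<close>

lemma bas_bracket_eigen:
  assumes "\<And>b \<phi>. coad t b \<phi> = \<xi> b * \<phi> b"
  shows "bracket q (bas t) (bas x) = \<xi> x *\<^sub>C bas x"
  by (rule kap_eqI)
    (auto simp: kap_bracket assms clinear_scaleC[OF clinear_kap] scaleC_complex_def kap_bas simp del: kap.simps)

lemma bracket_E_E: "bracket q (bas (Ev k)) (bas (Ev l)) = 0"
  by (rule kap_eqI, rename_tac b, case_tac b)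
    (auto simp: kap_bracket clinear_zero[OF clinear_kap] kap_bas dg_def simp del: kap.simps)

lemma bracket_E_F: "bracket q (bas (Ev k)) (bas (Fv l)) =
    (sq k l / 2) *\<^sub>C bas (Zv (k + l)) + (cq k l / 2) *\<^sub>C bas (Hv (k + l))"
  by (rule kap_eqI, rename_tac b, case_tac b)
    (auto simp: kap_bracket clinear_add[OF clinear_kap] clinear_scaleC[OF clinear_kap]
      scaleC_complex_def kap_bas dg_def sq_def cq_def tw_add_left tw_add_right
      simp del: kap.simps)

lemma bracket_H_E: "bracket q (bas (Hv k)) (bas (Ev l)) = cq k l *\<^sub>C bas (Ev (k + l))"
  and bracket_H_F: "bracket q (bas (Hv k)) (bas (Fv l)) = (- cq k l) *\<^sub>C bas (Fv (k + l))"
  and bracket_H_H: "bracket q (bas (Hv k)) (bas (Hv l)) = sq k l *\<^sub>C bas (Zv (k + l))"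
  and bracket_H_Z: "l \<noteq> 0 \<Longrightarrow> bracket q (bas (Hv k)) (bas (Zv l)) = sq k l *\<^sub>C bas (Hv (k + l))"
  and bracket_Z_H: "bracket q (bas (Zv k)) (bas (Hv l)) = sq k l *\<^sub>C bas (Hv (k + l))"
  and bracket_Z_Z: "bracket q (bas (Zv k)) (bas (Zv l)) = sq k l *\<^sub>C bas (Zv (k + l))"
  by (rule kap_eqI, rename_tac b, case_tac b;
    auto simp: kap_bracket clinear_add[OF clinear_kap] clinear_scaleC[OF clinear_kap]
      scaleC_complex_def kap_bas dg_def sq_def cq_def tw_add_left tw_add_right
      simp del: kap.simps)+

section \<open>Homogeneous derivations\<close>

definition weight_zero :: "sl2q_ext_sq \<Rightarrow> bool" where
  "weight_zero v \<longleftrightarrow> (\<forall>b b'. K b b' v \<noteq> 0 \<longrightarrow> wt b + wt b' = 0 \<and> deg b + deg b' = 0)"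

definition homogeneous :: "(sl2q_ext \<Rightarrow> sl2q_ext_sq) \<Rightarrow> bool" where
  "homogeneous D \<longleftrightarrow> D \<in> Der q \<and>
     (\<forall>x b b'. K b b' (D (bas x)) \<noteq> 0 \<longrightarrow> wt b + wt b' = wt x \<and> deg b + deg b' = deg x)"

lemma homogeneousD:
  assumes "homogeneous D"
  shows "D \<in> Der q" "wt b + wt b' \<noteq> wt x \<or> deg b + deg b' \<noteq> deg x \<Longrightarrow> K b b' (D (bas x)) = 0"
  using assms by (auto simp: homogeneous_def)

lemma homogeneous_weight:
  "homogeneous D \<Longrightarrow> K b b' (D (bas x)) \<noteq> 0 \<Longrightarrow> wt b + wt b' = wt x \<and> deg b + deg b' = deg x"
  unfolding homogeneous_def by blast

lemma K_action_weight:
  assumes "\<And>c c'. wt c + wt c' = wt b + wt b' - wt x \<Longrightarrow> deg c + deg c' = deg b + deg b' - deg x \<Longrightarrow>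
    K c c' v = 0"
  shows "K b b' (action q (bas x) v) = 0"
  unfolding K_action
  by (subst (1 2) coad_weight; simp add: assms)

lemma Der_diff_inner: "D \<in> Der q \<Longrightarrow> (\<lambda>x. D x - action q x v) \<in> Der q"
  using Inn_subset_Der[OF q_nonzero] by (intro Der_diff) (auto simp: Inn_def)

lemma homogeneous_diff_inner:
  assumes "homogeneous D" "weight_zero v"
  shows "homogeneous (\<lambda>x. D x - action q x v)"
  unfolding homogeneous_def
proof (intro conjI Der_diff_inner homogeneousD(1)[OF assms(1)] allI impI)
  fix x b b'
  assume *: "K b b' (D (bas x) - action q (bas x) v) \<noteq> 0"
  have "wt b + wt b' = wt x \<and> deg b + deg b' = deg x"
  proof (rule ccontr)
    assume **: "\<not> ?thesis"
    have "K b b' (action q (bas x) v) = 0"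
      using assms(2) ** by (intro K_action_weight) (force simp: weight_zero_def)
    moreover have "K b b' (D (bas x)) = 0" using homogeneousD(2)[OF assms(1)] ** by blast
    ultimately show False using * by simp
  qed
  then show "wt b + wt b' = wt x" "deg b + deg b' = deg x" by auto
qed

text \<open>Since \<open>\<bar>wt b + wt b' - wt x\<bar> \<le> 3\<close>, the single eigenvalue \<open>chi\<close> separates the weights that
  occur together.\<close>

definition chi :: "ix \<Rightarrow> complex" where
  "chi b = of_int (wt b + 4 * fst (deg b)) + \<i> * of_int (4 * snd (deg b))"

lemma wt_bound: "- 1 \<le> wt b" "wt b \<le> 1"
  by (cases b; simp)+

lemma chi_add: "chi b + chi b' = of_int (wt b + wt b' + 4 * fst (deg b + deg b')) +
    \<i> * of_int (4 * snd (deg b + deg b'))"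
  by (simp add: chi_def algebra_simps)

lemma chi_eq_iff: "chi b + chi b' = chi x \<longleftrightarrow> wt b + wt b' = wt x \<and> deg b + deg b' = deg x"
proof
  assume "chi b + chi b' = chi x"
  then have "real_of_int (wt b + wt b' + 4 * fst (deg b + deg b')) = of_int (wt x + 4 * fst (deg x))"
    "real_of_int (snd (deg b + deg b')) = of_int (snd (deg x))"
    by (simp_all add: complex_eq_iff chi_def)
  then have *: "wt b + wt b' + 4 * fst (deg b + deg b') = wt x + 4 * fst (deg x)"
    "snd (deg b + deg b') = snd (deg x)"
    by (simp_all only: of_int_eq_iff)
  moreover have "wt b + wt b' = wt x"
    using *(1) wt_bound[of b] wt_bound[of b'] wt_bound[of x] by presburger
  ultimately show "wt b + wt b' = wt x \<and> deg b + deg b' = deg x"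
    by (simp add: prod_eq_iff)
next
  assume "wt b + wt b' = wt x \<and> deg b + deg b' = deg x"
  then show "chi b + chi b' = chi x" unfolding chi_add by (simp add: chi_def)
qed

text \<open>One element \<open>t\<close> acts diagonally with eigenvalues that separate the weights.
  Once \<open>D t\<close> has only eigenvalue 0, the rule for [t, x] forces \<open>D\<close> to
  preserve eigenvalues.\<close>

lemma ex_homogeneous:
  assumes D: "D \<in> Der q"
  obtains v where "homogeneous (\<lambda>x. D x - action q x v)"
proof -
  \<comment> \<open>Chosen to have eigenvalue \<open>chi x\<close> at \<open>bas x\<close>; the
    factor 1/2 is there because \<open>Hv 0\<close> acts by twice \<open>wt\<close>.\<close>
  define t where "t = (1/2) *\<^sub>C bas (Hv 0) + 4 *\<^sub>C bas D1 + (4 * \<i>) *\<^sub>C bas D2"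
  have bracket_t: "bracket q t (bas x) = chi x *\<^sub>C bas x" for x
  proof -
    have "bracket q t (bas x) = ((1/2) * of_int (2 * wt x) + 4 * of_int (fst (deg x))
        + 4 * \<i> * of_int (snd (deg x))) *\<^sub>C bas x"
      unfolding t_def cbilinear_simps[OF cbilinear_bracket]
      by (simp only: bas_bracket_eigen[OF coad_torus(1)] bas_bracket_eigen[OF coad_torus(2)]
          bas_bracket_eigen[OF coad_torus(3)] scaleC_scaleC scaleC_add_left)
    then show ?thesis by (simp add: chi_def algebra_simps)
  qed
  have K_t: "K b b' (action q t v) = (chi b + chi b') * K b b' v" for b b' v
    by (simp add: t_def action_add action_scaleC K_action coad_torus chi_def algebra_simps)
  \<comment> \<open>Division by zero gives 0, so the part of \<open>D t\<close> with eigenvalue 0 is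
    left untouched.\<close>
  obtain v where v: "\<And>b b'. K b b' v = K b b' (D t) / (chi b + chi b')"
    by (rule ex_tensor[OF finite_K[of "D t"], of "\<lambda>b b'. K b b' (D t) / (chi b + chi b')"]) auto
  define D' where "D' x = D x - action q x v" for x
  have D': "D' \<in> Der q" unfolding D'_def by (rule Der_diff_inner[OF D])
  have D't: "K b b' (D' t) = 0" if "chi b + chi b' \<noteq> 0" for b b'
    using that by (simp add: D'_def K_t v)
  have "K b b' (D' (bas x)) = 0" if "\<not> (wt b + wt b' = wt x \<and> deg b + deg b' = deg x)" for x b b'
  proof -
    have ne: "chi b + chi b' \<noteq> chi x" using that by (simp add: chi_eq_iff)
    \<comment> \<open>Since \<open>D' t\<close> has eigenvalue 0, this tensor has eigenvalue
      \<open>chi x\<close>, which is not that of the index pair.\<close>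
    have "K b b' (action q (bas x) (D' t)) = 0"
    proof (rule K_action_weight)
      fix c c'
      assume "wt c + wt c' = wt b + wt b' - wt x" "deg c + deg c' = deg b + deg b' - deg x"
      then have w: "wt c + wt c' = wt b + wt b' - wt x"
        "fst (deg c) + fst (deg c') = fst (deg b) + fst (deg b') - fst (deg x)"
        "snd (deg c) + snd (deg c') = snd (deg b) + snd (deg b') - snd (deg x)"
        by (auto simp: prod_eq_iff)
      have "chi c + chi c' = of_int ((wt c + wt c') + 4 * (fst (deg c) + fst (deg c'))) +
          \<i> * of_int (4 * (snd (deg c) + snd (deg c')))"
        by (simp add: chi_def algebra_simps)
      also have "\<dots> = chi b + chi b' - chi x" unfolding w by (simp add: chi_def algebra_simps)
      finally show "K c c' (D' t) = 0" using ne D't by simp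
    qed
    moreover have "chi x * K b b' (D' (bas x)) = K b b' (D' (bracket q t (bas x)))"
      by (simp add: bracket_t clinear_scaleC[OF Der_clinear[OF D']])
    ultimately have "chi x * K b b' (D' (bas x)) = (chi b + chi b') * K b b' (D' (bas x))"
      by (simp add: Der_bracket[OF D'] K_t)
    then show ?thesis using ne by auto
  qed
  then have "homogeneous D'" unfolding homogeneous_def using D' by blast
  then show thesis using that by (simp add: D'_def[abs_def])
qed

text \<open>\<open>Ev 0\<close> and \<open>Fv 0\<close> remove the mixed \<open>Hv\<close> entries
  and tie the \<open>Ev\<close>-\<open>Fv\<close> entries to the \<open>Hv\<close>-\<open>Hv\<close>
  ones. The latter are constant along the infinite antidiagonal, hence zero; elements
  \<open>Ev k\<close> of well chosen degree remove the rest.\<close>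

lemma invariant_eq_0:
  assumes wz: "weight_zero v"
    and E: "\<And>k. action q (bas (Ev k)) v = 0" and F0: "action q (bas (Fv 0)) v = 0"
  shows "v = 0"
proof (rule K_zeroI)
  have eqE: "coad (Ev k) b (\<lambda>c. K c b' v) + coad (Ev k) b' (\<lambda>c. K b c v) = 0" for k b b'
    using arg_cong[OF E[of k], of "K b b'"] by (simp add: K_action)
  have eqF: "coad (Fv 0) b (\<lambda>c. K c b' v) + coad (Fv 0) b' (\<lambda>c. K b c v) = 0" for b b'
    using arg_cong[OF F0, of "K b b'"] by (simp add: K_action)
  have HZ: "K (Hv a) (Zv b) v = 0" "K (Zv b) (Hv a) v = 0" "K (Hv a) D1 v = 0" "K D1 (Hv a) v = 0"
    "K (Hv a) D2 v = 0" "K D2 (Hv a) v = 0" for a b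
    using eqE[of 0 "Ev a" "Zv b"] eqE[of 0 "Zv b" "Ev a"] eqE[of 0 "Ev a" D1] eqE[of 0 D1 "Ev a"]
      eqE[of 0 "Ev a" D2] eqE[of 0 D2 "Ev a"]
    by (simp_all add: dg_0)
  have EF: "K (Ev a) (Fv b) v = 2 * K (Hv a) (Hv b) v" "K (Fv b) (Ev a) v = 2 * K (Hv b) (Hv a) v" for a b
    using eqF[of "Hv a" "Fv b"] eqF[of "Fv b" "Hv a"] by (simp_all add: dg_0)
  \<comment> \<open>The coordinate (\<open>Ev a\<close>, \<open>Hv b\<close>) under
    \<open>Ev (a + b)\<close> couples just these two entries: the shift by a + b takes a to -b and b
    to -a.\<close>
  have const: "K (Hv (- b)) (Hv b) v = K (Hv a) (Hv (- a)) v" for a b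
  proof -
    have c: "cq (a + b) a = cq b a" "cq (a + b) b = cq b a"
      by (simp_all add: cq_def tw_add_left tw_add_right add.commute)
    have dg: "dg m (\<lambda>c. K c (Hv b) v) = 0" for m b by (simp add: dg_def HZ)
    have "cq b a * (K (Hv a) (Hv (- a)) v - K (Hv (- b)) (Hv b) v) = 0"
      using eqE[of "a + b" "Ev a" "Hv b"] by (simp add: EF HZ c dg algebra_simps split: if_splits)
    then show ?thesis by simp
  qed
  have HH: "K (Hv a) (Hv b) v = 0" for a b
  proof -
    have "\<exists>n. K (Hv n) (Hv (- n)) v = 0"
    proof (rule ccontr)
      assume "\<not> ?thesis"
      then have "range (\<lambda>n. (Hv n, Hv (- n))) \<subseteq> {(b, b'). K b b' v \<noteq> 0}" by auto
      then have "finite (range (\<lambda>n. (Hv n, Hv (- n))))" using finite_K finite_subset by blast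
      moreover have "inj (\<lambda>n. (Hv n, Hv (- n)))" by (auto intro: injI)
      ultimately have "finite (UNIV :: (int \<times> int) set)" using finite_imageD by blast
      then show False using infinite_UNIV_char_0[where 'a = int] by (simp add: finite_prod)
    qed
    then obtain n where "K (Hv n) (Hv (- n)) v = 0" by blast
    then have "K (Hv a) (Hv (- a)) v = 0" using const[of "- n" n] const[of "- n" a] by simp
    moreover have "K (Hv a) (Hv b) v = 0" if "b \<noteq> - a"
      using wz[unfolded weight_zero_def, rule_format, of "Hv a" "Hv b"] that
      by (auto simp: eq_neg_iff_add_eq_0 add.commute)
    ultimately show ?thesis by blast
  qed
  have EF0: "K (Ev a) (Fv b) v = 0" "K (Fv b) (Ev a) v = 0" for a b
    by (simp_all add: EF HH)
  have ZZ: "K (Zv a) (Zv b) v = 0" for a b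
  proof (cases "a = 0")
    case False
    have *: "sq l a * K (Zv a) (Zv b) v = 0" for l
      using eqE[of l "Ev (a + l)" "Zv b"] False
      by (simp add: HZ EF0 sq_def tw_add_right tw_add_left split: if_splits)
    then show ?thesis using ex_sq_nonzero[OF False] by auto
  qed simp
  have ZD: "K D1 (Zv b) v = 0" "K (Zv b) D1 v = 0" "K D2 (Zv b) v = 0" "K (Zv b) D2 v = 0" for b
    using eqE[of "(1, 0)" "Ev (1, 0)" "Zv b"] eqE[of "(1, 0)" "Zv b" "Ev (1, 0)"]
      eqE[of "(0, 1)" "Ev (0, 1)" "Zv b"] eqE[of "(0, 1)" "Zv b" "Ev (0, 1)"]
    by (simp_all add: HZ EF0 ZZ dg_def)
  have DD: "K D1 D1 v = 0" "K D1 D2 v = 0" "K D2 D1 v = 0" "K D2 D2 v = 0"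
    using eqE[of "(1, 0)" "Ev (1, 0)" D1] eqE[of "(1, 0)" "Ev (1, 0)" D2]
      eqE[of "(0, 1)" "Ev (0, 1)" D1] eqE[of "(0, 1)" "Ev (0, 1)" D2]
    by (simp_all add: HZ EF0 ZD dg_def)
  show "K b b' v = 0" for b b'
  proof (cases "wt b + wt b' = 0")
    case True
    then show ?thesis by (cases b; cases b'; simp add: HH HZ EF0 ZZ ZD DD)
  next
    case False
    then show ?thesis using wz by (auto simp: weight_zero_def)
  qed
qed

text \<open>For \<open>t\<close> in the torus both D [t, x] and t . D x are the eigenvalue of
  \<open>x\<close> times D x, so the derivation rule leaves x . D t = 0 for every basis
  element.\<close>

lemma homogeneous_torus:
  assumes D: "homogeneous D"
  shows "D (bas D1) = 0" "D (bas D2) = 0" "D (bas (Hv 0)) = 0"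
proof -
  have main: "D (bas t) = 0"
    if \<xi>: "\<And>b \<phi>. coad t b \<phi> = \<xi> b * \<phi> b" and t: "wt t = 0" "deg t = 0"
      and \<xi>_add: "\<And>b b' x. wt b + wt b' = wt x \<Longrightarrow> deg b + deg b' = deg x \<Longrightarrow> \<xi> b + \<xi> b' = \<xi> x" for t \<xi>
  proof -
    have "action q (bas x) (D (bas t)) = 0" for x
    proof (rule K_zeroI)
      fix b b'
      have "\<xi> x * K b b' (D (bas x)) = K b b' (D (bracket q (bas t) (bas x)))"
        by (simp add: bas_bracket_eigen[OF \<xi>] clinear_scaleC[OF Der_clinear[OF homogeneousD(1)[OF D]]])
      also have "\<dots> = (\<xi> b + \<xi> b') * K b b' (D (bas x)) - K b b' (action q (bas x) (D (bas t)))"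
        by (simp add: Der_bracket[OF homogeneousD(1)[OF D]] K_action \<xi> distrib_right)
      also have "(\<xi> b + \<xi> b') * K b b' (D (bas x)) = \<xi> x * K b b' (D (bas x))"
        using homogeneousD(2)[OF D, of b b' x] \<xi>_add[of b b' x] by (cases "K b b' (D (bas x)) = 0") auto
      finally show "K b b' (action q (bas x) (D (bas t))) = 0" by simp
    qed
    moreover have "weight_zero (D (bas t))"
      using homogeneous_weight[OF D, of _ _ t] t by (simp add: weight_zero_def)
    ultimately show ?thesis by (blast intro: invariant_eq_0)
  qed
  show "D (bas D1) = 0"
    by (rule main[OF coad_torus(1)]) (simp_all add: of_int_add[symmetric] fst_add[symmetric]
        del: of_int_add fst_add)
  show "D (bas D2) = 0"
    by (rule main[OF coad_torus(2)]) (simp_all add: of_int_add[symmetric] snd_add[symmetric]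
        del: of_int_add snd_add)
  show "D (bas (Hv 0)) = 0"
    by (rule main[OF coad_torus(3)]) (simp_all add: of_int_add[symmetric] distrib_left[symmetric]
        del: of_int_add)
qed

section \<open>Reduction to \<open>sl\<^sub>2\<close>-equivariant derivations\<close>

text \<open>A preimage under the action of \<open>Ev 0\<close>: for instance \<open>Ev 0\<close> maps \<open>Ev a \<otimes> Fv b\<close> to \<open>Ev a \<otimes> Hv b\<close>,
  and \<open>Hv a \<otimes> Zv b\<close> to \<open>- 2\<close> times \<open>Ev a \<otimes> Zv b\<close>.\<close>

fun raise_preimage :: "(ix \<Rightarrow> ix \<Rightarrow> complex) \<Rightarrow> ix \<Rightarrow> ix \<Rightarrow> complex" where
  "raise_preimage A (Ev a) (Fv b) = A (Ev a) (Hv b)"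
| "raise_preimage A (Fv a) (Ev b) = A (Hv a) (Ev b)"
| "raise_preimage A (Hv a) (Hv b) = 0"
| "raise_preimage A (Hv a) (Ev b) = 0"
| "raise_preimage A (Hv a) (Fv b) = 0"
| "raise_preimage A (Hv a) y = - A (Ev a) y / 2"
| "raise_preimage A (Ev a) (Hv b) = 0"
| "raise_preimage A (Fv a) (Hv b) = 0"
| "raise_preimage A y (Hv a) = - A y (Ev a) / 2"
| "raise_preimage A _ _ = 0"

text \<open>Bounds the support of \<open>raise_preimage A\<close>: each nonzero entry comes from an
  entry of \<open>A\<close> by lowering one index.\<close>

fun lower :: "ix \<Rightarrow> ix" where
  "lower (Ev m) = Hv m" | "lower (Hv m) = Fv m" | "lower b = b"

text \<open>Together with the vanishing at \<open>Hv 0\<close> from homogeneity, this makes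
  \<open>D\<close> commute with the action of the degree-zero sl_2.\<close>

definition sl2_equivariant :: "(sl2q_ext \<Rightarrow> sl2q_ext_sq) \<Rightarrow> bool" where
  "sl2_equivariant D \<longleftrightarrow> homogeneous D \<and> D (bas (Ev 0)) = 0 \<and> D (bas (Fv 0)) = 0"

text \<open>By sl_2-theory the raising operator maps weight 0 onto weight 1 and is injective on
  weight -1. The first fact removes the value at \<open>Ev 0\<close>, the second then the value at
  \<open>Fv 0\<close>.\<close>

lemma ex_sl2_equivariant:
  assumes D: "homogeneous D"
  obtains v where "weight_zero v" "sl2_equivariant (\<lambda>x. D x - action q x v)"
proof -
  define A where "A b b' = K b b' (D (bas (Ev 0)))" for b b'
  have A: "A b b' = 0" if "wt b + wt b' \<noteq> 1 \<or> deg b + deg b' \<noteq> 0" for b b'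
    unfolding A_def using homogeneousD(2)[OF D, of b b' "Ev 0"] that by simp
  let ?S = "{(b, b'). A b b' \<noteq> 0}"
  define T where "T = (\<lambda>(b, b'). (lower b, b')) ` ?S \<union> (\<lambda>(b, b'). (b, lower b')) ` ?S"
  have T: "(lower b, b') \<in> T \<and> (b, lower b') \<in> T" if "A b b' \<noteq> 0" for b b'
    unfolding T_def using that by force
  have supp: "(b, b') \<in> T" if "raise_preimage A b b' \<noteq> 0" for b b'
    by (cases b; cases b'; insert that; simp; drule T; simp)
  obtain v where v: "\<And>b b'. K b b' v = raise_preimage A b b'"
  proof (rule ex_tensor[of T "raise_preimage A"])
    show "finite T" using finite_K[of "D (bas (Ev 0))"] by (simp add: A_def T_def)
    show "raise_preimage A b b' = 0" if "(b, b') \<notin> T" for b b' using supp that by blast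
    have "A (Zv 0) b = 0" "A b (Zv 0) = 0" for b by (simp_all add: A_def)
    then show "raise_preimage A (Zv 0) b = 0" "raise_preimage A b (Zv 0) = 0" for b
      by (cases b; simp)+
  qed blast
  have wz: "weight_zero v"
    unfolding weight_zero_def v
  proof (intro allI impI)
    fix b b' assume nz: "raise_preimage A b b' \<noteq> 0"
    have A': "wt c + wt c' = 1 \<and> deg c + deg c' = 0" if "A c c' \<noteq> 0" for c c'
      using A that by blast
    show "wt b + wt b' = 0 \<and> deg b + deg b' = 0"
      by (cases b; cases b'; insert nz; simp; drule A'; simp)
  qed
  define D' where "D' x = D x - action q x v" for x
  have D': "homogeneous D'" unfolding D'_def by (rule homogeneous_diff_inner[OF D wz])
  have E: "D' (bas (Ev 0)) = 0"
  proof (rule K_zeroI)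
    fix b b'
    show "K b b' (D' (bas (Ev 0))) = 0"
    proof (cases "wt b + wt b' = 1")
      case True
      then show ?thesis
        by (cases b; cases b'; simp add: D'_def K_action v dg_0 A_def[symmetric])
    next
      case False
      then show ?thesis using homogeneousD(2)[OF D'] by simp
    qed
  qed
  \<comment> \<open>This bracket is \<open>bas (Hv 0)\<close>, so \<open>Ev 0\<close> annihilates
    the value at \<open>Fv 0\<close>, a tensor of weight -1.\<close>
  have "D' (bracket q (bas (Ev 0)) (bas (Fv 0))) = 0"
    using homogeneous_torus(3)[OF D'] by (simp add: bracket_E_F scaleC_one)
  then have "action q (bas (Ev 0)) (D' (bas (Fv 0))) = 0"
    by (simp add: Der_bracket[OF homogeneousD(1)[OF D']] E clinear_zero[OF clinear_action])
  then have eq: "coad (Ev 0) b (\<lambda>c. K c b' (D' (bas (Fv 0)))) +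
      coad (Ev 0) b' (\<lambda>c. K b c (D' (bas (Fv 0)))) = 0"
    for b b'
    using K_action[of b b' "Ev 0" "D' (bas (Fv 0))"] by simp
  have F: "D' (bas (Fv 0)) = 0"
  proof (rule K_zeroI)
    fix b b'
    show "K b b' (D' (bas (Fv 0))) = 0"
    proof (cases "wt b + wt b' = - 1")
      case True
      then consider m n where "b = Fv m" "b' = Hv n" | m n where "b = Hv n" "b' = Fv m"
        | m where "b = Fv m" "\<forall>n. b' \<noteq> Hv n" "wt b' = 0" | m where "b' = Fv m" "\<forall>n. b \<noteq> Hv n" "wt b = 0"
        by (cases b; cases b'; simp)
      then show ?thesis
      proof cases
        case 1
        then show ?thesis using eq[of "Fv m" "Ev n"] by (simp add: dg_0)
      next
        case 2
        then show ?thesis using eq[of "Ev n" "Fv m"] by (simp add: dg_0)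
      next
        case 3
        then show ?thesis using eq[of "Hv m" b'] by (cases b') simp_all
      next
        case 4
        then show ?thesis using eq[of b "Hv m"] by (cases b) simp_all
      qed
    next
      case False
      then show ?thesis using homogeneousD(2)[OF D'] by simp
    qed
  qed
  show thesis using that[OF wz] D' E F unfolding sl2_equivariant_def D'_def[abs_def] by blast
qed

end

section \<open>Finitely supported functions on the lattice\<close>

text \<open>A single point would bring along the whole ray n, n + l, n + 2l, ..., which is
  infinite.\<close>

lemma finite_shift_invariant:
  fixes l :: "int \<times> int"
  assumes fin: "finite {n. P n}" and shift: "\<And>n. P n \<Longrightarrow> P (n + l)" and l: "l \<noteq> 0"
  shows "\<not> P n"
proof
  assume "P n"
  have P: "P (n + (of_nat t * fst l, of_nat t * snd l))" for t
  proof (induction t)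
    case 0
    then show ?case using \<open>P n\<close> by (simp add: zero_prod_def[symmetric])
  next
    case (Suc t)
    have "n + (of_nat (Suc t) * fst l, of_nat (Suc t) * snd l) =
        n + (of_nat t * fst l, of_nat t * snd l) + l"
      by (simp add: prod_eq_iff algebra_simps)
    then show ?case using shift[OF Suc] by metis
  qed
  have "inj (\<lambda>t. n + (of_nat t * fst l, of_nat t * snd l))"
    using l by (auto intro!: injI simp: prod_eq_iff)
  moreover have "range (\<lambda>t. n + (of_nat t * fst l, of_nat t * snd l)) \<subseteq> {n. P n}"
    using P by auto
  ultimately show False
    using fin finite_imageD finite_subset infinite_UNIV_nat by blast
qed

lemma int_shift_const:
  fixes f :: "int \<Rightarrow> 'a"
  assumes "\<And>i. f (i + 1) = f i"
  shows "f i = f j"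
proof -
  have "f i = f 0" for i
  proof (induction i rule: int_induct[of _ 0])
    case (step2 i)
    then show ?case using assms[of "i - 1"] by simp
  qed (use assms in simp_all)
  then show ?thesis by metis
qed

text \<open>This fails for the integers in place of the lattice: it holds because the lattice has one end.\<close>

lemma lattice_potential:
  fixes u w :: "int \<times> int \<Rightarrow> 'a::ab_group_add"
  assumes fin: "finite {m. u m \<noteq> 0}" "finite {m. w m \<noteq> 0}"
    and curl: "\<And>m. w m + u (m + (0, 1)) = u m + w (m + (1, 0))"
  obtains \<alpha> where "finite {m. \<alpha> m \<noteq> 0}"
    "\<And>m. \<alpha> m - \<alpha> (m + (1, 0)) = u m" "\<And>m. \<alpha> m - \<alpha> (m + (0, 1)) = w m"
proof -
  let ?S = "{m. u m \<noteq> 0} \<union> {m. w m \<noteq> 0}"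
  have "finite ((\<lambda>m. \<bar>fst m\<bar>) ` ?S \<union> (\<lambda>m. \<bar>snd m\<bar>) ` ?S)" using fin by simp
  then obtain N where N: "\<forall>x \<in> (\<lambda>m. \<bar>fst m\<bar>) ` ?S \<union> (\<lambda>m. \<bar>snd m\<bar>) ` ?S. x \<le> N"
    by (meson bdd_above_def bdd_above_finite)
  have supp: "u (i, j) = 0" "w (i, j) = 0" if "\<bar>i\<bar> > N \<or> \<bar>j\<bar> > N" for i j
    using N that by (force simp: not_le[symmetric])+
  \<comment> \<open>Integration of \<open>u\<close> from the right: the sum telescopes in the first
    coordinate and is empty beyond the support.\<close>
  define \<alpha> where "\<alpha> m = (\<Sum>t\<in>{fst m..N}. u (t, snd m))" for m
  have u: "\<alpha> m - \<alpha> (m + (1, 0)) = u m" for m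
  proof (cases m)
    case (Pair i j)
    show ?thesis
    proof (cases "i \<le> N")
      case True
      then have "{i..N} = insert i {i + 1..N}" by auto
      then show ?thesis by (simp add: \<alpha>_def Pair)
    next
      case False
      then have "u (i, j) = 0" by (intro supp) linarith
      then show ?thesis using False by (simp add: \<alpha>_def Pair)
    qed
  qed
  \<comment> \<open>The error in the vertical equation: \<open>curl\<close> makes it independent of
    \<open>i\<close>, and it vanishes far to the right.\<close>
  define \<beta> where "\<beta> i j = \<alpha> (i, j) - \<alpha> (i, j + 1) - w (i, j)" for i j
  have "\<beta> (i + 1) j = \<beta> i j" for i j
  proof -
    have "\<alpha> (i + 1, j) = \<alpha> (i, j) - u (i, j)" "\<alpha> (i + 1, j + 1) = \<alpha> (i, j + 1) - u (i, j + 1)"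
      using u[of "(i, j)"] u[of "(i, j + 1)"] by (auto simp: algebra_simps)
    moreover have "w (i + 1, j) = w (i, j) + u (i, j + 1) - u (i, j)"
      using curl[of "(i, j)"] by (simp add: algebra_simps)
    ultimately show ?thesis by (simp add: \<beta>_def)
  qed
  then have "\<beta> i j = \<beta> (\<bar>N\<bar> + 1) j" for i j by (rule int_shift_const)
  moreover have "\<beta> (\<bar>N\<bar> + 1) j = 0" for j
  proof -
    have "w (\<bar>N\<bar> + 1, j) = 0" by (intro supp) linarith
    then show ?thesis by (simp add: \<beta>_def \<alpha>_def)
  qed
  ultimately have \<beta>: "\<alpha> (i, j) - \<alpha> (i, j + 1) = w (i, j)" for i j
    by (simp add: \<beta>_def)
  have zero: "\<alpha> (i, j) = 0" if "\<bar>i\<bar> > \<bar>N\<bar> \<or> \<bar>j\<bar> > \<bar>N\<bar>" for i j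
  proof (cases "\<bar>j\<bar> > \<bar>N\<bar>")
    case True
    then have "u (t, j) = 0" for t by (intro supp) linarith
    then show ?thesis by (simp add: \<alpha>_def)
  next
    case False
    then have "\<bar>i\<bar> > \<bar>N\<bar>" using that by blast
    then consider "i > \<bar>N\<bar>" | "i < - \<bar>N\<bar>" by linarith
    then show ?thesis
    proof cases
      case 2
      \<comment> \<open>To the left of the support the definition of \<open>\<alpha>\<close> does
        not give zero. But \<open>w\<close> vanishes there, so the column is constant and can be
        compared with a height above the support: this is the way around that a line lacks.\<close>
      have "w (i, j') = 0" for j' by (intro supp) (use 2 in linarith)
      then have "\<alpha> (i, j' + 1) = \<alpha> (i, j')" for j' using \<beta>[of i j'] by simp
      then have "\<alpha> (i, j) = \<alpha> (i, \<bar>N\<bar> + 1)" by (rule int_shift_const)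
      also have "\<dots> = 0"
      proof -
        have "u (t, \<bar>N\<bar> + 1) = 0" for t by (intro supp) linarith
        then show ?thesis by (simp add: \<alpha>_def)
      qed
      finally show ?thesis .
    qed (simp add: \<alpha>_def)
  qed
  have "{m. \<alpha> m \<noteq> 0} \<subseteq> {- \<bar>N\<bar>..\<bar>N\<bar>} \<times> {- \<bar>N\<bar>..\<bar>N\<bar>}"
    using zero by (force simp: not_less[symmetric])
  then have "finite {m. \<alpha> m \<noteq> 0}" by (rule finite_subset) simp
  moreover have "\<alpha> m - \<alpha> (m + (0, 1)) = w m" for m
    by (cases m) (simp add: \<beta>)
  ultimately show thesis using that u by blast
qed

context quantum_torus_root
begin

section \<open>The components in \<open>E\<^sub>1\<^sub>2 \<otimes> E\<^sub>2\<^sub>1\<close>\<close>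

text \<open>Left and right multiplication separate on \<open>E\<^sub>1\<^sub>2 \<otimes> E\<^sub>2\<^sub>1\<close>: \<open>gel k\<close> multiplies
  the first factor from the left and the second one from the right.\<close>

definition gel :: "int \<times> int \<Rightarrow> sl2q_ext" where
  "gel k = (1/2) *\<^sub>C (bas (Zv k) + bas (Hv k))"

text \<open>The sides are exchanged: \<open>hel k\<close> multiplies the first factor from the right
  and the second one from the left.\<close>

definition hel :: "int \<times> int \<Rightarrow> sl2q_ext" where
  "hel k = (1/2) *\<^sub>C (bas (Zv k) - bas (Hv k))"

lemma bas_Zv_0: "bas (Zv 0) = 0"
  by (rule kap_eqI) (simp add: kap_bas clinear_zero[OF clinear_kap] del: kap.simps)

lemma action_diff: "action q (x - y) v = action q x v - action q y v"
  using action_add[of q "x - y" y v] by simp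

lemma bracket_gel:
  assumes "l \<noteq> 0"
  shows "bracket q (gel k) (gel l) = sq k l *\<^sub>C gel (k + l)" "bracket q (gel k) (hel l) = 0"
proof -
  let ?X = "sq k l *\<^sub>C (bas (Zv (k + l)) + bas (Hv (k + l)))"
  have "bracket q (bas (Zv k) + bas (Hv k)) (bas (Zv l) + bas (Hv l)) = ?X + ?X"
    by (simp add: cbilinear_simps[OF cbilinear_bracket] bracket_Z_Z bracket_Z_H bracket_H_H
        bracket_H_Z assms scaleC_add_right algebra_simps)
  then have "bracket q (gel k) (gel l) = (1/4) *\<^sub>C (?X + ?X)"
    by (simp only: gel_def cbilinear_simps(3,4)[OF cbilinear_bracket] scaleC_scaleC) simp
  also have "\<dots> = (1/2) *\<^sub>C ?X"
    by (simp only: scaleC_add_right[of "1/4" ?X] scaleC_add_left[symmetric]) simp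
  finally show "bracket q (gel k) (gel l) = sq k l *\<^sub>C gel (k + l)"
    by (simp add: gel_def scaleC_scaleC mult.commute)
  show "bracket q (gel k) (hel l) = 0"
    by (simp add: gel_def hel_def cbilinear_simps[OF cbilinear_bracket]
        cbilinear_diff[OF cbilinear_bracket] bracket_Z_Z bracket_Z_H bracket_H_H bracket_H_Z assms)
qed

lemma K_gel:
  "K (Ev a) (Fv b) (action q (gel k) v) =
    tw k a * K (Ev (a - k)) (Fv b) v - tw b k * K (Ev a) (Fv (b - k)) v"
  by (simp add: gel_def action_add action_scaleC K_action sq_def cq_def field_simps)

lemma K_hel:
  "K (Ev a) (Fv b) (action q (hel k) v) =
    tw k b * K (Ev a) (Fv (b - k)) v - tw a k * K (Ev (a - k)) (Fv b) v"
  by (simp add: hel_def action_diff action_scaleC K_action sq_def cq_def field_simps)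

text \<open>Dividing by \<open>tw k m\<close> untwists the cocycle: a tensor with coordinate
  \<open>\<alpha> m\<close> at (\<open>Ev m\<close>, \<open>Fv (- m)\<close>) contributes the plain
  coboundary \<open>\<alpha> m - \<alpha> (m + k)\<close>.\<close>

definition gcoef :: "(sl2q_ext \<Rightarrow> sl2q_ext_sq) \<Rightarrow> int \<times> int \<Rightarrow> int \<times> int \<Rightarrow> complex" where
  "gcoef D k m = K (Ev (m + k)) (Fv (- m)) (D (gel k)) / tw k m"

text \<open>An associative product rule for X^k X^l or X^l X^k would equate
  \<open>gcoef D (k + l) m\<close> with one of the two parenthesized sums; the commutator yields
  only their twisted difference.\<close>

lemma gcoef_relation:
  assumes D: "D \<in> Der q" and l: "l \<noteq> 0"
  shows "sq k l * gcoef D (k + l) m =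
    tw k l * (gcoef D l m + gcoef D k (m + l)) - tw l k * (gcoef D k m + gcoef D l (m + k))"
proof -
  let ?K = "\<lambda>a x. K (Ev a) (Fv (- m)) x"
  have c: "K (Ev (m + k)) (Fv (- m)) (D (gel k)) = tw k m * gcoef D k m" for k m
    by (simp add: gcoef_def)
  have c': "K (Ev (m + k + l)) (Fv (- m - l)) (D (gel k)) = tw k (m + l) * gcoef D k (m + l)" for k l
    using c[of "m + l" k] by (simp add: add.assoc add.commute[of l k])
  have "tw (k + l) m * (sq k l * gcoef D (k + l) m) = ?K (m + k + l) (D (bracket q (gel k) (gel l)))"
    using c[of m "k + l"] by (simp add: bracket_gel[OF l] clinear_scaleC[OF Der_clinear[OF D]] add.assoc)
  also have "\<dots> = ?K (m + k + l) (action q (gel k) (D (gel l))) - ?K (m + k + l) (action q (gel l) (D (gel k)))"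
    by (simp add: Der_bracket[OF D])
  also have "?K (m + k + l) (action q (gel k) (D (gel l))) =
      tw (k + l) m * (tw k l * gcoef D l m - tw l k * gcoef D l (m + k))"
    using c[of m l] c'[of l k] 
    by (simp add: K_gel tw_simps algebra_simps tw_commute[of m])
  also have "?K (m + k + l) (action q (gel l) (D (gel k))) =
      tw (k + l) m * (tw l k * gcoef D k m - tw k l * gcoef D k (m + l))"
    using c[of m k] c'[of k l]
    by (simp add: K_gel tw_simps algebra_simps tw_commute[of m])
  finally have "tw (k + l) m * (sq k l * gcoef D (k + l) m) = tw (k + l) m *
      ((tw k l * gcoef D l m - tw l k * gcoef D l (m + k)) - (tw l k * gcoef D k m - tw k l * gcoef D k (m + l)))"
    by (simp only: right_diff_distrib[symmetric])
  then have "sq k l * gcoef D (k + l) m =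
      (tw k l * gcoef D l m - tw l k * gcoef D l (m + k)) - (tw l k * gcoef D k m - tw k l * gcoef D k (m + l))"
    by (simp only: mult_cancel_left tw_nonzero simp_thms)
  then show ?thesis by (simp add: algebra_simps)
qed

lemma finite_gcoef: "finite {m. gcoef D k m \<noteq> 0}"
proof -
  have "(\<lambda>m. (Ev (m + k), Fv (- m))) ` {m. gcoef D k m \<noteq> 0} \<subseteq> {(b, b'). K b b' (D (gel k)) \<noteq> 0}"
    by (auto simp: gcoef_def)
  then have "finite ((\<lambda>m. (Ev (m + k), Fv (- m))) ` {m. gcoef D k m \<noteq> 0})"
    by (rule finite_subset[OF _ finite_K])
  then show ?thesis by (rule finite_imageD) (auto intro: inj_onI)
qed

text \<open>The relation for the pair \<open>l\<close>, \<open>l\<close> is empty. The commuting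
  pair \<open>l + l\<close>, \<open>l\<close> shows instead that the defect is invariant under
  translation by \<open>l\<close>, so its finite support is empty.\<close>

lemma gcoef_double:
  assumes D: "D \<in> Der q" and l: "l \<noteq> 0"
  shows "gcoef D (l + l) m = gcoef D l m + gcoef D l (m + l)"
proof -
  let ?f = "\<lambda>m. gcoef D (l + l) m - gcoef D l m - gcoef D l (m + l)"
  have "l + l \<noteq> 0" using l by (auto simp: prod_eq_iff)
  then have f: "?f (m + l) = ?f m" for m
    using gcoef_relation[OF D, of "l + l" l m] by (simp add: tw_simps sq_def algebra_simps)
  have "\<not> ?f m \<noteq> 0"
  proof (rule finite_shift_invariant[where P = "\<lambda>m. ?f m \<noteq> 0", OF _ _ l])
    have "{m. ?f m \<noteq> 0} \<subseteq> {m. gcoef D (l + l) m \<noteq> 0} \<union> {m. gcoef D l m \<noteq> 0} \<union>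
        (\<lambda>m. m - l) ` {m. gcoef D l m \<noteq> 0}" (is "_ \<subseteq> ?S")
      by (auto simp: image_iff algebra_simps simp del: split_paired_Ex intro: exI[of _ "_ + l"])
    moreover have "finite ?S" by (simp add: finite_gcoef)
    ultimately show "finite {m. ?f m \<noteq> 0}" by (rule finite_subset)
  qed (simp only: f not_False_eq_True)
  then show ?thesis by (simp add: algebra_simps)
qed

text \<open>Degree k + 2l is reached as k + (l + l) and as (k + l) + l. Comparing the two gives the
  defect \<open>?R\<close> a twisted translation law along \<open>l\<close>.\<close>

lemma gcoef_curl:
  assumes D: "D \<in> Der q" and kl: "sq k l \<noteq> 0"
  shows "gcoef D l m + gcoef D k (m + l) = gcoef D k m + gcoef D l (m + k)"
proof -
  define r where "r = tw k l"
  define r' where "r' = tw l k"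
  have rr: "r * r' = 1" "r \<noteq> 0" "r' \<noteq> 0" by (simp_all add: r_def r'_def tw_commute[of l k])
  have nz: "l \<noteq> 0" "l + l \<noteq> 0"
    using kl by (auto simp: prod_eq_iff sq_eq_0_iff)
  have s: "sq k l = r - r'" "sq (k + l) l = r - r'" "sq k (l + l) = r * r - r' * r'"
    "tw (k + l) l = r" "tw l (k + l) = r'" "tw k (l + l) = r * r" "tw (l + l) k = r' * r'"
    by (simp_all add: sq_def tw_simps r_def r'_def)
  let ?R = "\<lambda>m. gcoef D l m + gcoef D k (m + l) - (gcoef D k m + gcoef D l (m + k))"
  have step: "r * ?R (m + l) = r' * ?R m" for m
  proof -
    define u0 u1 u2 where "u0 = gcoef D k m" "u1 = gcoef D k (m + l)" "u2 = gcoef D k (m + l + l)"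
    define w0 w1 wk wkl where "w0 = gcoef D l m" "w1 = gcoef D l (m + l)" "wk = gcoef D l (m + k)"
      "wkl = gcoef D l (m + k + l)"
    define v0 v1 v2 where "v0 = gcoef D (k + l) m" "v1 = gcoef D (k + l) (m + l)" "v2 = gcoef D (k + l + l) m"
    note defs = u0_u1_u2_def w0_w1_wk_wkl_def v0_v1_v2_def
    have 1: "(r - r') * v0 = r * (w0 + u1) - r' * (u0 + wk)"
      using gcoef_relation[OF D nz(1), of k m] unfolding s r_def[symmetric] r'_def[symmetric] defs by simp
    have 2: "(r - r') * v1 = r * (w1 + u2) - r' * (u1 + wkl)"
      using gcoef_relation[OF D nz(1), of k "m + l"] unfolding s r_def[symmetric] r'_def[symmetric] defs
      by (simp add: add.assoc add.commute[of l k])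
    have 3: "(r * r - r' * r') * v2 = r * r * (w0 + w1 + u2) - r' * r' * (u0 + wk + wkl)"
      using gcoef_relation[OF D nz(2), of k m] unfolding s defs gcoef_double[OF D nz(1)]
      by (simp add: add.assoc)
    have 4: "(r - r') * v2 = r * (w0 + v1) - r' * (v0 + wkl)"
      using gcoef_relation[OF D nz(1), of "k + l" m] unfolding s defs by (simp add: add.assoc)
    \<comment> \<open>Subtracting r + r' times 4 from 3 eliminates \<open>v2\<close>; after
      multiplication by r - r', facts 1 and 2 eliminate \<open>v0\<close> and
      \<open>v1\<close>.\<close>
    have "2 * (r * r') * (r * (w1 + u2 - u1 - wkl) - r' * (w0 + u1 - u0 - wk)) = 0"
      using 1 2 3 4 by algebra
    then have "r * (w1 + u2 - u1 - wkl) = r' * (w0 + u1 - u0 - wk)"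
      using rr by simp
    then show ?thesis by (simp add: defs algebra_simps)
  qed
  have "\<not> ?R m \<noteq> 0"
  proof (rule finite_shift_invariant[where P = "\<lambda>m. ?R m \<noteq> 0", OF _ _ nz(1)])
    let ?S = "{m. gcoef D l m \<noteq> 0} \<union> (\<lambda>m. m - l) ` {m. gcoef D k m \<noteq> 0} \<union> {m. gcoef D k m \<noteq> 0} \<union>
        (\<lambda>m. m - k) ` {m. gcoef D l m \<noteq> 0}"
    have "{m. ?R m \<noteq> 0} \<subseteq> ?S"
    proof
      fix m assume "m \<in> {m. ?R m \<noteq> 0}"
      then consider "gcoef D l m \<noteq> 0" | "gcoef D k m \<noteq> 0" | "gcoef D k (m + l) \<noteq> 0" | "gcoef D l (m + k) \<noteq> 0"
        by force
      then show "m \<in> ?S"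
      proof cases
        case 3
        then have "m + l - l \<in> (\<lambda>m. m - l) ` {m. gcoef D k m \<noteq> 0}" by blast
        then show ?thesis by simp
      next
        case 4
        then have "m + k - k \<in> (\<lambda>m. m - k) ` {m. gcoef D l m \<noteq> 0}" by blast
        then show ?thesis by simp
      qed simp_all
    qed
    moreover have "finite ?S" by (simp add: finite_gcoef)
    ultimately show "finite {m. ?R m \<noteq> 0}" by (rule finite_subset)
    show "?R (m + l) \<noteq> 0" if "?R m \<noteq> 0" for m
    proof
      assume "?R (m + l) = 0"
      then have "r' * ?R m = 0" using step[of m] by (simp only: mult_zero_right)
      then show False using that rr by simp
    qed
  qed
  then show ?thesis by simp
qed

text \<open>For each single degree \<open>a\<close> the sum of the three kinds of terms is already
  invariant under the degree-zero sl_2, so any finitely supported \<open>\<alpha>\<close> preserves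
  equivariance.\<close>

fun casimir :: "(int \<times> int \<Rightarrow> complex) \<Rightarrow> ix \<Rightarrow> ix \<Rightarrow> complex" where
  "casimir \<alpha> (Ev a) (Fv b) = (if a + b = 0 then \<alpha> a else 0)"
| "casimir \<alpha> (Fv a) (Ev b) = (if a + b = 0 then \<alpha> a else 0)"
| "casimir \<alpha> (Hv a) (Hv b) = (if a + b = 0 then \<alpha> a / 2 else 0)"
| "casimir \<alpha> _ _ = 0"

lemma sl2_equivariant_diff_inner:
  assumes D: "sl2_equivariant D" and v: "weight_zero v"
    and inv: "\<And>b b'. K b b' (action q (bas (Ev 0)) v) = 0" "\<And>b b'. K b b' (action q (bas (Fv 0)) v) = 0"
  shows "sl2_equivariant (\<lambda>x. D x - action q x v)"
  using D homogeneous_diff_inner[OF _ v, of D] K_zeroI[OF inv(1)] K_zeroI[OF inv(2)]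
  by (simp add: sl2_equivariant_def)

lemma ex_gcoef_eq_0:
  assumes D: "sl2_equivariant D"
  obtains v where "weight_zero v" "sl2_equivariant (\<lambda>x. D x - action q x v)"
    "\<And>m. gcoef (\<lambda>x. D x - action q x v) (1, 0) m = 0" "\<And>m. gcoef (\<lambda>x. D x - action q x v) (0, 1) m = 0"
proof -
  have Der: "D \<in> Der q" using D by (simp add: sl2_equivariant_def homogeneous_def)
  have "sq (1, 0) (0, 1) \<noteq> 0" by (simp add: sq_eq_0_iff)
  note curl = gcoef_curl[OF Der this]
  obtain \<alpha> where \<alpha>: "finite {m. \<alpha> m \<noteq> 0}" "\<And>m. \<alpha> m - \<alpha> (m + (1, 0)) = gcoef D (1, 0) m"
    "\<And>m. \<alpha> m - \<alpha> (m + (0, 1)) = gcoef D (0, 1) m"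
    using lattice_potential[OF finite_gcoef finite_gcoef curl] by blast
  let ?A = "{m. \<alpha> m \<noteq> 0}"
  define T where "T = (\<lambda>m. (Ev m, Fv (- m))) ` ?A \<union> (\<lambda>m. (Fv m, Ev (- m))) ` ?A \<union> (\<lambda>m. (Hv m, Hv (- m))) ` ?A"
  have supp: "(b, b') \<in> T" if "casimir \<alpha> b b' \<noteq> 0" for b b'
    unfolding T_def
    by (cases b; cases b'; insert that; simp split: if_splits; simp add: image_iff add_eq_0_iff
      del: split_paired_Ex)
  obtain v where v: "\<And>b b'. K b b' v = casimir \<alpha> b b'"
  proof (rule ex_tensor[of T "casimir \<alpha>"])
    show "finite T" using \<alpha>(1) by (simp add: T_def)
    show "casimir \<alpha> b b' = 0" if "(b, b') \<notin> T" for b b' using supp that by blast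
    show "casimir \<alpha> (Zv 0) b = 0" "casimir \<alpha> b (Zv 0) = 0" for b by (cases b; simp)+
  qed blast
  have wz: "weight_zero v"
    unfolding weight_zero_def v
  proof (intro allI impI)
    fix b b' assume nz: "casimir \<alpha> b b' \<noteq> 0"
    show "wt b + wt b' = 0 \<and> deg b + deg b' = 0"
      by (cases b; cases b'; insert nz; simp split: if_splits)
  qed
  have inv: "K b b' (action q (bas (Ev 0)) v) = 0" "K b b' (action q (bas (Fv 0)) v) = 0" for b b'
    by (cases b; cases b'; simp add: K_action v dg_def)+
  have "K (Ev (m + k)) (Fv (- m)) (action q (gel k) v) = tw k m * (\<alpha> m - \<alpha> (m + k))" for k m
    by (simp add: K_gel v tw_simps tw_commute[of m k] algebra_simps)
  then have "gcoef (\<lambda>x. D x - action q x v) k m = gcoef D k m - (\<alpha> m - \<alpha> (m + k))" for k m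
    by (simp add: gcoef_def diff_divide_distrib)
  then show thesis
    using that[OF wz sl2_equivariant_diff_inner[OF D wz inv]] \<alpha>(2,3) by simp
qed

text \<open>For \<open>k\<close> nonzero one of the two unit degrees is not collinear with
  \<open>k\<close>; as its coefficients vanish, \<open>gcoef_curl\<close> makes
  \<open>gcoef D k\<close> invariant under that translation. Degree 0 lies in the torus.\<close>

lemma K_gel_eq_0:
  assumes D: "homogeneous D"
    and 1: "\<And>m. gcoef D (1, 0) m = 0" and 2: "\<And>m. gcoef D (0, 1) m = 0"
  shows "K (Ev a) (Fv b) (D (gel k)) = 0"
proof -
  have Der: "D \<in> Der q" and lin: "clinear D"
    using homogeneousD(1)[OF D] Der_clinear by auto
  have weights: "K (Ev a) (Fv b) (D (bas (Zv k))) = 0" "K (Ev a) (Fv b) (D (bas (Hv k))) = 0" if "a + b \<noteq> k"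
    using homogeneousD(2)[OF D, of "Ev a" "Fv b" "Zv k"] homogeneousD(2)[OF D, of "Ev a" "Fv b" "Hv k"] that
    by simp_all
  have D_gel: "D (gel k) = (1/2) *\<^sub>C (D (bas (Zv k)) + D (bas (Hv k)))" for k
    by (simp add: gel_def clinear_scaleC[OF lin] clinear_add[OF lin])
  show ?thesis
  proof (cases "a + b = k \<and> k \<noteq> 0")
    case True
    obtain l where l: "l = (1, 0) \<or> l = (0, 1)" and sq: "sq k l \<noteq> 0"
      using ex_sq_nonzero[of k] True by (auto simp: sq_commute[of k])
    have zero: "gcoef D l m = 0" for m using l 1 2 by metis
    have "\<not> gcoef D k m \<noteq> 0" for m
    proof (rule finite_shift_invariant[where P = "\<lambda>m. gcoef D k m \<noteq> 0" and l = l, OF finite_gcoef])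
      show "gcoef D k (m + l) \<noteq> 0" if "gcoef D k m \<noteq> 0" for m
        using gcoef_curl[OF Der sq, of m] that by (simp add: zero)
    qed (use l in \<open>auto simp: zero_prod_def\<close>)
    then have "gcoef D k (- b) = 0" by blast
    moreover have "- b + k = a" using True by (auto simp: algebra_simps)
    ultimately show ?thesis by (simp add: gcoef_def)
  next
    case False
    then show ?thesis
      using weights homogeneous_torus(3)[OF D]
      by (cases "k = 0") (simp_all add: D_gel bas_Zv_0 clinear_zero[OF lin])
  qed
qed

text \<open>\<open>hel k\<close> commutes with \<open>gel (1, 0)\<close>, whose value has no such
  component. Hence the component of \<open>D (hel k)\<close> satisfies a translation law along (1,
  0) with nonzero factors.\<close>

lemma K_hel_eq_0:
  assumes D: "homogeneous D" and gel: "\<And>k a b. K (Ev a) (Fv b) (D (gel k)) = 0"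
  shows "K (Ev a) (Fv b) (D (hel k)) = 0"
proof (cases "k = 0")
  case True
  then show ?thesis
    using homogeneous_torus(3)[OF D] Der_clinear[OF homogeneousD(1)[OF D]]
    by (simp add: hel_def bas_Zv_0 clinear_scaleC clinear_minus)
next
  case False
  have Der: "D \<in> Der q" by (rule homogeneousD(1)[OF D])
  let ?l = "(1, 0) :: int \<times> int"
  have "action q (gel ?l) (D (hel k)) = action q (hel k) (D (gel ?l))"
    using Der_bracket[OF Der, of "gel ?l" "hel k"] clinear_zero[OF Der_clinear[OF Der]]
    by (simp add: bracket_gel(2)[OF False])
  then have *: "tw ?l a * K (Ev (a - ?l)) (Fv b) (D (hel k)) = tw b ?l * K (Ev a) (Fv (b - ?l)) (D (hel k))" for a b
    using K_gel[of a b ?l "D (hel k)"] K_hel[of a b k "D (gel ?l)"] by (simp add: gel)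
  let ?P = "\<lambda>n. K (Ev (a + n)) (Fv (b - n)) (D (hel k)) \<noteq> 0"
  have "\<not> ?P 0"
  proof (rule finite_shift_invariant[where P = ?P and l = ?l])
    have "(\<lambda>n. (Ev (a + n), Fv (b - n))) ` {n. ?P n} \<subseteq> {(b, b'). K b b' (D (hel k)) \<noteq> 0}" by auto
    then have "finite ((\<lambda>n. (Ev (a + n), Fv (b - n))) ` {n. ?P n})"
      by (rule finite_subset[OF _ finite_K])
    then show "finite {n. ?P n}" by (rule finite_imageD) (auto intro: inj_onI)
    show "?P (n + ?l)" if "?P n" for n
    proof
      assume "K (Ev (a + (n + ?l))) (Fv (b - (n + ?l))) (D (hel k)) = 0"
      moreover have "a + (n + ?l) - ?l = a + n" "b - (n + ?l) = b - n - ?l" by (simp_all add: algebra_simps)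
      ultimately have "tw ?l (a + (n + ?l)) * K (Ev (a + n)) (Fv (b - n)) (D (hel k)) = 0"
        using *[of "a + (n + ?l)" "b - n"] by simp
      then show False using that by simp
    qed
  qed (simp add: zero_prod_def)
  then show ?thesis by simp
qed

lemma K_E_F_eq_0:
  assumes D: "homogeneous D" and "\<And>m. gcoef D (1, 0) m = 0" "\<And>m. gcoef D (0, 1) m = 0"
  shows "K (Ev a) (Fv b) (D (bas (Hv k))) = 0"
proof -
  note gel = K_gel_eq_0[OF assms]
  have "gel k - hel k = bas (Hv k)"
  proof -
    have "gel k - hel k = (1/2) *\<^sub>C bas (Hv k) + (1/2) *\<^sub>C bas (Hv k)"
      by (simp add: gel_def hel_def scaleC_add_right cvec.scale_right_diff_distrib)
    then show ?thesis by (simp add: scaleC_add_left[symmetric] scaleC_one)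
  qed
  then have "D (bas (Hv k)) = D (gel k) - D (hel k)"
    by (metis clinear_diff[OF Der_clinear[OF homogeneousD(1)[OF D]]])
  then show ?thesis using gel K_hel_eq_0[OF D gel] by simp
qed

section \<open>The remaining components\<close>

text \<open>\<open>Hv k\<close> is the bracket of \<open>Ev k\<close> with \<open>Fv 0\<close>,
  where \<open>D\<close> vanishes; the values at \<open>Ev k\<close> thus determine the
  others.\<close>

lemma D_Hv:
  assumes D: "sl2_equivariant D"
  shows "D (bas (Hv k)) = - action q (bas (Fv 0)) (D (bas (Ev k)))"
  using D Der_bracket[of D q "bas (Ev k)" "bas (Fv 0)"]
  by (simp add: bracket_E_F scaleC_one sl2_equivariant_def homogeneous_def clinear_zero[OF clinear_action])

lemma K_uminus [simp]: "K b b' (- v) = - K b b' v"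
  using K_simps(3)[of b b' 0 v] by simp

lemma K_D_Hv:
  assumes D: "sl2_equivariant D"
  shows "K b b' (D (bas (Hv k))) = - coad (Fv 0) b (\<lambda>c. K c b' (D (bas (Ev k))))
    - coad (Fv 0) b' (\<lambda>c. K b c (D (bas (Ev k))))"
  by (simp add: D_Hv[OF D] K_action)

text \<open>\<open>Fv 0\<close> lowers the first kind of entry to the vanishing
  \<open>Ev\<close>-\<open>Fv\<close> entries. The reversed order follows because
  \<open>Ev 0\<close> commutes with \<open>Ev k\<close> and so annihilates its value.\<close>

lemma K_E_H_eq_0:
  assumes D: "sl2_equivariant D" and EF: "\<And>a b k. K (Ev a) (Fv b) (D (bas (Hv k))) = 0"
  shows "K (Ev a) (Hv b) (D (bas (Ev k))) = 0" "K (Hv b) (Ev a) (D (bas (Ev k))) = 0"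
proof -
  show EH: "K (Ev a) (Hv b) (D (bas (Ev k))) = 0" for a b
    using K_D_Hv[OF D, of "Ev a" "Fv b" k] by (simp add: EF dg_0)
  have Der: "D \<in> Der q" and E0: "D (bas (Ev 0)) = 0"
    using D by (simp_all add: sl2_equivariant_def homogeneous_def)
  have "action q (bas (Ev 0)) (D (bas (Ev k))) = 0"
    using Der_bracket[OF Der, of "bas (Ev 0)" "bas (Ev k)"]
    by (simp add: bracket_E_E E0 clinear_zero[OF clinear_action] clinear_zero[OF Der_clinear[OF Der]])
  then have "K (Ev b) (Ev a) (action q (bas (Ev 0)) (D (bas (Ev k)))) = 0" by simp
  then show "K (Hv b) (Ev a) (D (bas (Ev k))) = 0"
    by (simp add: K_action EH dg_0)
qed

text \<open>This is the coordinate (\<open>Ev a\<close>, \<open>Hv b\<close>) of the rule for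
  [\<open>Hv k\<close>, \<open>Ev l\<close>] once the known zeros are dropped. It separates
  variables: one side involves only the value at \<open>Ev l\<close>, the other only that at
  \<open>Ev k\<close>.\<close>

lemma K_D_Ev_relation:
  assumes D: "sl2_equivariant D" and EF: "\<And>a b k. K (Ev a) (Fv b) (D (bas (Hv k))) = 0"
  shows "sq k b * K (Ev a) (Zv (b - k)) (D (bas (Ev l)))
      - (if b = k then dg k (\<lambda>c. K (Ev a) c (D (bas (Ev l)))) else 0) =
    sq l a * K (Zv (a - l)) (Ev b) (D (bas (Ev k)))
      - (if a = l then dg l (\<lambda>c. K c (Ev b) (D (bas (Ev k)))) else 0)"
proof -
  note EH = K_E_H_eq_0[OF D EF]
  have Der: "D \<in> Der q" using D by (simp add: sl2_equivariant_def homogeneous_def)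
  have "K (Ev a) (Hv b) (D (bracket q (bas (Hv k)) (bas (Ev l)))) = 0"
    by (simp add: bracket_H_E clinear_scaleC[OF Der_clinear[OF Der]] EH)
  then have "K (Ev a) (Hv b) (action q (bas (Hv k)) (D (bas (Ev l)))) =
      K (Ev a) (Hv b) (action q (bas (Ev l)) (D (bas (Hv k))))"
    by (simp add: Der_bracket[OF Der])
  moreover have "K (Hv x) (Hv y) (D (bas (Hv k))) = 0" for x y
    by (simp add: K_D_Hv[OF D] EH)
  moreover have "K (Zv x) (Hv b) (D (bas (Hv k))) = K (Zv x) (Ev b) (D (bas (Ev k)))" for x
    by (simp add: K_D_Hv[OF D])
  moreover have "K D1 (Hv b) (D (bas (Hv k))) = K D1 (Ev b) (D (bas (Ev k)))"
    "K D2 (Hv b) (D (bas (Hv k))) = K D2 (Ev b) (D (bas (Ev k)))"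
    by (simp_all add: K_D_Hv[OF D])
  ultimately show ?thesis
    by (simp add: K_action EH EF dg_def)
qed

fun center_coef :: "(int \<times> int \<Rightarrow> complex) \<Rightarrow> (ix \<Rightarrow> ix \<Rightarrow> complex) \<Rightarrow> ix \<Rightarrow> ix \<Rightarrow> complex" where
  "center_coef \<beta> \<tau> (Zv a) (Zv b) = (if a + b = 0 \<and> a \<noteq> 0 then \<beta> a else 0)"
| "center_coef \<beta> \<tau> D1 D1 = \<tau> D1 D1"
| "center_coef \<beta> \<tau> D1 D2 = \<tau> D1 D2"
| "center_coef \<beta> \<tau> D2 D1 = \<tau> D2 D1"
| "center_coef \<beta> \<tau> D2 D2 = \<tau> D2 D2"
| "center_coef \<beta> \<tau> _ _ = 0"

text \<open>The \<open>Ev l\<close> and \<open>Fv 0\<close> generate all but d_1 and d_2: brackets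
  with \<open>Fv 0\<close> give \<open>Hv k\<close> and then \<open>Fv k\<close>, and
  \<open>Zv n\<close> appears in [\<open>Ev (n - l)\<close>, \<open>Fv l\<close>] with a nonzero
  \<open>sq\<close> for suitable \<open>l\<close>.\<close>

lemma derivation_eq_0:
  assumes D: "sl2_equivariant D" and E: "\<And>l. D (bas (Ev l)) = 0"
  shows "D x = 0"
proof -
  have hom: "homogeneous D" and Der: "D \<in> Der q" and F0: "D (bas (Fv 0)) = 0"
    using D by (simp_all add: sl2_equivariant_def homogeneous_def)
  note lin = Der_clinear[OF Der] and zero = clinear_zero[OF clinear_action]
  have H: "D (bas (Hv k)) = 0" for k
    by (simp add: D_Hv[OF D] E zero)
  have F: "D (bas (Fv k)) = 0" for k
    using Der_bracket[OF Der, of "bas (Hv k)" "bas (Fv 0)"]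
    by (simp add: bracket_H_F H F0 zero clinear_scaleC[OF lin] clinear_minus[OF lin])
  have Z: "D (bas (Zv n)) = 0" for n
  proof (cases "n = 0")
    case True
    then show ?thesis by (simp add: bas_Zv_0 clinear_zero[OF lin])
  next
    case False
    then obtain l where l: "sq l n \<noteq> 0" using ex_sq_nonzero by blast
    have "sq (n - l) l = - sq l n" by (simp add: sq_def tw_simps)
    then show ?thesis
      using Der_bracket[OF Der, of "bas (Ev (n - l))" "bas (Fv l)"] l
      by (simp add: bracket_E_F E F H zero clinear_add[OF lin] clinear_diff[OF lin] clinear_scaleC[OF lin])
  qed
  have "D (bas b) = 0" for b
    using homogeneous_torus[OF hom] by (cases b) (simp_all add: E F H Z)
  moreover have "D x = (\<Sum>b\<in>{b. kap b x \<noteq> 0}. D (kap b x *\<^sub>C bas b))"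
    by (subst kap_expansion[OF finite_kap, of x x]) (simp_all add: clinear_sum[OF lin] del: kap.simps)
  ultimately show ?thesis by (simp add: clinear_scaleC[OF lin] del: kap.simps)
qed

lemma ex_inner_of_EF_eq_0:
  assumes D: "sl2_equivariant D" and EF: "\<And>a b k. K (Ev a) (Fv b) (D (bas (Hv k))) = 0"
  obtains v where "\<And>x. D x = action q x v"
proof -
  define A where "A l b b' = K b b' (D (bas (Ev l)))" for l b b'
  have hom: "homogeneous D" using D by (simp add: sl2_equivariant_def)
  note rel = K_D_Ev_relation[OF D EF, folded A_def]
  note A_EH = K_E_H_eq_0[OF D EF, folded A_def]
  \<comment> \<open>A unit degree not collinear with \<open>n\<close>. As it takes only two values,
    \<open>\<beta>\<close> is read off from two tensors and has finite support.\<close>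
  define l0 where "l0 n = (if sq (1, 0) n \<noteq> 0 then (1, 0) else (0, 1) :: int \<times> int)" for n
  have l0: "sq (l0 n) n \<noteq> 0" if "n \<noteq> 0" for n
    using ex_sq_nonzero[OF that] by (auto simp: l0_def)
  define \<beta> where "\<beta> n = A (l0 n) (Ev (l0 n + n)) (Zv (- n)) / sq (l0 n) n" for n
  \<comment> \<open>With \<open>n\<close> fixed, \<open>k\<close> and \<open>l\<close> are
    separated, so each value is its \<open>sq\<close> times a constant, and the constants are
    opposite.\<close>
  have rel_Z: "- sq k n * A l (Ev (l + n)) (Zv (- n)) = sq l n * A k (Zv n) (Ev (k - n))" if "n \<noteq> 0" for k l n
    using rel[where k = k and b = "k - n" and a = "l + n" and l = l] that
    by (simp add: sq_def tw_simps tw_commute[of n k])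
  have A_ZE: "A k (Zv n) (Ev (k - n)) = - sq k n * \<beta> n" if "n \<noteq> 0" for k n
    using rel_Z[OF that, of k "l0 n"] l0[OF that] by (simp add: \<beta>_def field_simps)
  have A_EZ: "A l (Ev (l + n)) (Zv (- n)) = sq l n * \<beta> n" if "n \<noteq> 0" for l n
    using rel_Z[OF that, of "l0 n" l] l0[OF that] by (simp add: A_ZE[OF that] field_simps)
  have rel_D: "dg k (A l (Ev l)) = dg l (\<lambda>c. A k c (Ev k))" for k l
    using rel[where k = k and b = k and a = l and l = l] by (simp add: A_def)
  \<comment> \<open>By \<open>rel_D\<close> these entries form a bilinear form in the two degrees
    with matrix \<open>- \<tau>\<close>; the sign comes from [\<open>Ev l\<close>, d_i] = - l_i
    \<open>Ev l\<close>.\<close>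
  define \<tau> where "\<tau> i j = (if i = D1 then - A (1, 0) (Ev (1, 0)) j else - A (0, 1) (Ev (0, 1)) j)" for i j
  have A_DE: "A k D1 (Ev k) = - dg k (\<tau> D1)" "A k D2 (Ev k) = - dg k (\<tau> D2)" for k
    using rel_D[of k "(1, 0)"] rel_D[of k "(0, 1)"] by (simp_all add: dg_def \<tau>_def add.commute)
  have A_ED: "A l (Ev l) D1 = - dg l (\<lambda>i. \<tau> i D1)" "A l (Ev l) D2 = - dg l (\<lambda>i. \<tau> i D2)" for l
    using rel_D[of "(1, 0)" l] rel_D[of "(0, 1)" l]
    by (simp_all add: A_DE dg_def)
  let ?S = "{(b, b'). A (1, 0) b b' \<noteq> 0} \<union> {(b, b'). A (0, 1) b b' \<noteq> 0}"
  define T where "T = (\<lambda>(b, b'). (Zv (- deg b'), b')) ` ?S \<union> {D1, D2} \<times> {D1, D2}"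
  have supp: "(b, b') \<in> T" if nz: "center_coef \<beta> \<tau> b b' \<noteq> 0" for b b'
  proof -
    have "(Zv n, Zv (- n)) \<in> T" if "n \<noteq> 0" "\<beta> n \<noteq> 0" for n
    proof -
      have "A (l0 n) (Ev (l0 n + n)) (Zv (- n)) \<noteq> 0" using that(2) by (auto simp: \<beta>_def)
      then have "(Ev (l0 n + n), Zv (- n)) \<in> ?S"
        by (cases "sq (1, 0) n = 0") (simp_all add: l0_def)
      then show ?thesis unfolding T_def by (rule UnI1[OF image_eqI[rotated]]) simp
    qed
    then show ?thesis
      by (cases b; cases b'; insert nz; simp add: T_def add_eq_0_iff split: if_splits)
  qed
  obtain v where v: "\<And>b b'. K b b' v = center_coef \<beta> \<tau> b b'"
  proof (rule ex_tensor[of T "center_coef \<beta> \<tau>"])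
    show "finite T" by (simp add: T_def A_def finite_K)
    show "center_coef \<beta> \<tau> b b' = 0" if "(b, b') \<notin> T" for b b' using supp that by blast
    show "center_coef \<beta> \<tau> (Zv 0) b = 0" "center_coef \<beta> \<tau> b (Zv 0) = 0" for b by (cases b; simp)+
  qed blast
  have wz: "weight_zero v"
    unfolding weight_zero_def v
  proof (intro allI impI)
    fix b b' assume nz: "center_coef \<beta> \<tau> b b' \<noteq> 0"
    show "wt b + wt b' = 0 \<and> deg b + deg b' = 0"
      by (cases b; cases b'; insert nz; simp split: if_splits)
  qed
  have inv: "K b b' (action q (bas (Ev 0)) v) = 0" "K b b' (action q (bas (Fv 0)) v) = 0" for b b'
    by (cases b; cases b'; simp add: K_action v dg_def)+
  define D' where "D' x = D x - action q x v" for x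
  have D': "sl2_equivariant D'"
    unfolding D'_def by (rule sl2_equivariant_diff_inner[OF D wz inv])
  have "D' (bas (Ev l)) = 0" for l
  proof (rule K_zeroI)
    fix b b'
    have D'_eq: "K b b' (D' (bas (Ev l))) = A l b b' - coad (Ev l) b (\<lambda>c. center_coef \<beta> \<tau> c b')
        - coad (Ev l) b' (center_coef \<beta> \<tau> b)" 
      by (simp add: D'_def A_def K_action v)
    show "K b b' (D' (bas (Ev l))) = 0"
    proof (cases "wt b + wt b' = 1 \<and> deg b + deg b' = l")
      case False
      then show ?thesis
        using homogeneousD(2)[of D' b b' "Ev l"] D' by (auto simp: sl2_equivariant_def)
    next
      case True
      have deg: "m = l - n" if "m + n = l" for m n :: "int \<times> int" using that by auto
      consider (EZ) n where "b = Ev (l + n)" "b' = Zv (- n)" | (ZE) n where "b = Zv n" "b' = Ev (l - n)"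
        | (ED) "b = Ev l" "b' = D1 \<or> b' = D2" | (DE) "b = D1 \<or> b = D2" "b' = Ev l"
        | (EH) m n where "b = Ev m" "b' = Hv n" | (HE) m n where "b = Hv n" "b' = Ev m"
      proof (cases b)
        case (Ev m)
        then have "wt b' = 0" "deg b' = l - m" using True by (auto simp: algebra_simps)
        then show thesis
          using Ev that(1)[of "m - l"] that(3,5) by (cases b') auto
      next
        case (Zv n)
        then show thesis using True that(2)[of n] by (cases b') (auto simp: algebra_simps)
      qed (use True that(4,6) in \<open>cases b'; auto\<close>)+
      then show ?thesis
      proof cases
        case EZ
        show ?thesis
        proof (cases "n = 0")
          case False
          then show ?thesis unfolding D'_eq by (simp add: EZ A_EZ sq_def tw_simps)
        qed (simp add: EZ)
      next
        case ZE
        show ?thesis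
        proof (cases "n = 0")
          case False
          then show ?thesis unfolding D'_eq by (simp add: ZE A_ZE sq_def tw_simps tw_commute[of n l])
        qed (simp add: ZE)
      next
        case ED
        then show ?thesis unfolding D'_eq by (auto simp: A_ED dg_def)
      next
        case DE
        then show ?thesis unfolding D'_eq by (auto simp: A_DE dg_def)
      next
        case EH
        then show ?thesis using True unfolding D'_eq by (simp add: A_EH dg_def)
      next
        case HE
        then show ?thesis using True unfolding D'_eq by (simp add: A_EH dg_def)
      qed
    qed
  qed
  then have "D' x = 0" for x by (rule derivation_eq_0[OF D'])
  then show thesis using that by (simp add: D'_def)
qed

theorem Der_subset_Inn: "Der q \<subseteq> Inn q"
proof
  fix D assume "D \<in> Der q"
  then obtain v1 where 1: "homogeneous (\<lambda>x. D x - action q x v1)" by (rule ex_homogeneous)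
  then obtain v2 where 2: "sl2_equivariant (\<lambda>x. D x - action q x v1 - action q x v2)"
    by (rule ex_sl2_equivariant)
  then obtain v3 where 3: "sl2_equivariant (\<lambda>x. D x - action q x v1 - action q x v2 - action q x v3)"
    "\<And>m. gcoef (\<lambda>x. D x - action q x v1 - action q x v2 - action q x v3) (1, 0) m = 0"
    "\<And>m. gcoef (\<lambda>x. D x - action q x v1 - action q x v2 - action q x v3) (0, 1) m = 0"
    by (rule ex_gcoef_eq_0) blast
  have "homogeneous (\<lambda>x. D x - action q x v1 - action q x v2 - action q x v3)"
    using 3(1) by (simp add: sl2_equivariant_def)
  note EF = K_E_F_eq_0[OF this 3(2,3)]
  obtain v4 where "\<And>x. D x - action q x v1 - action q x v2 - action q x v3 = action q x v4"
    using ex_inner_of_EF_eq_0[OF 3(1) EF] by blast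
  then have "D x = action q x (v1 + v2 + v3 + v4)" for x
    by (simp add: clinear_add[OF clinear_action] algebra_simps)
  then show "D \<in> Inn q" unfolding Inn_def by blast
qed

end

theorem proposition3p4:
  fixes q :: complex
  assumes "q \<noteq> 0"
    and "\<And>n::nat. n > 0 \<Longrightarrow> q ^ n \<noteq> 1"
  shows "Der q = Inn q \<and> H1 q = {Inn q}"
proof -
  interpret quantum_torus_root "csqrt q" q
  proof
    have "csqrt q ^ 2 = q" by simp
    then show "q = csqrt q * csqrt q" by (simp add: power2_eq_square)
    show "csqrt q \<noteq> 0" using assms(1) by simp
    show "csqrt q ^ n \<noteq> 1" if "n > 0" for n
    proof
      assume "csqrt q ^ n = 1"
      then have "(csqrt q ^ 2) ^ n = 1" by (simp only: power_mult[symmetric] mult.commute[of 2 n]) (simp add: power_mult)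
      then show False using assms(2)[OF that] by simp
    qed
  qed
  have eq: "Der q = Inn q"
    using Der_subset_Inn Inn_subset_Der[OF assms(1)] by blast
  have ne: "(\<lambda>x. action q x 0) \<in> Inn q" by (auto simp: Inn_def)
  \<comment> \<open>Once every derivation is inner, so is every difference of two: all pairs are
    related and there is one class.\<close>
  have "{(D, D'). D \<in> Der q \<and> D' \<in> Der q \<and> (\<lambda>x. D x - D' x) \<in> Inn q} = Inn q \<times> Inn q"
    using Der_diff eq by auto
  then have "H1 q = Inn q // (Inn q \<times> Inn q)" by (simp add: H1_def eq)
  also have "\<dots> = {Inn q}" using ne by (auto simp: quotient_def)
  finally show ?thesis using eq by blast
qed

end
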